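(* Let $\Lambda_\infty=(r_0=0,r_1,r_2,\dots)$ be strictly increasing with $\lim_{n\to\infty}r_n=\infty$ and $\sum_{i=1}^\infty 1/r_i=\infty$, and let $0<a<1$. Then for every fixed positive integer $k$, $$\lim_{m\to\infty}\ \max_{0\le i\le m}\Bigl|\eta_i(t^{r_1},\Lambda_m,[a,1])^{r_k/r_1}-\eta_i(t^{r_k},\Lambda_m,[a,1])\Bigr|=0 .$$
   Context: For a sequence $0=r_0<r_1<r_2<\cdots$ of reals, write $\Lambda_n=(r_0,\dots,r_n)$ and $E(\Lambda_n)=\mathrm{span}(t^{r_0}=1,t^{r_1},\dots,t^{r_n})$ (functions on $]0,\infty[$). For an interval $[a,b]$ with $0<a<b$, the Chebyshev–Bernstein basis $(B^n_{0,\Lambda_n},\dots,B^n_{n,\Lambda_n})$ of $E(\Lambda_n)$ over $[a,b]$ is the unique basis of $E(\Lambda_n)$ with $\sum_{k=0}^n B^n_{k,\Lambda_n}\equiv 1$ such that, for each $k$, $B^n_{k,\Lambda_n}$ has a zero of multiplicity (exactly) $k$ at $a$ and of multiplicity $n-k$ at $b$. For $P\in E(\Lambda_n)$ and $m\ge n$, the control points $\eta_i(P,\Lambda_m,[a,b])$, $i=0,\dots,m$, are defined by $P(t)=\sum_{i=0}^m B^m_{i,\Lambda_m}(t)\,\eta_i(P,\Lambda_m,[a,b])$. *)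

theory Defs
  imports "HOL-Analysis.Analysis"
begin

text \<open>Muntz space E(Lambda_n) = span(t^{r_0},...,t^{r_n}), as functions on ]0,oo[
  (represented as total real functions given by the coefficient expression).\<close>
definition muntz_space :: "(nat \<Rightarrow> real) \<Rightarrow> nat \<Rightarrow> (real \<Rightarrow> real) set" where
  "muntz_space r n = {f. \<exists>c::nat \<Rightarrow> real. f = (\<lambda>t. \<Sum>j\<le>n. c j * t powr r j)}"

definition zero_mult :: "(real \<Rightarrow> real) \<Rightarrow> real \<Rightarrow> nat \<Rightarrow> bool" where
  "zero_mult f x k \<longleftrightarrow> (\<forall>j<k. (deriv ^^ j) f x = 0) \<and> (deriv ^^ k) f x \<noteq> 0"

text \<open>B 0, ..., B n is a Chebyshev-Bernstein basis of E(Lambda_n) over [a,b]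
  (B k is fixed to be 0 for k > n to make the family unique).\<close>
definition is_CB_basis ::
  "(nat \<Rightarrow> real) \<Rightarrow> nat \<Rightarrow> real \<Rightarrow> real \<Rightarrow> (nat \<Rightarrow> real \<Rightarrow> real) \<Rightarrow> bool" where
  "is_CB_basis r n a b B \<longleftrightarrow>
     (\<forall>k\<le>n. B k \<in> muntz_space r n) \<and> (\<forall>k>n. B k = (\<lambda>_. 0)) \<and>
     (\<forall>P\<in>muntz_space r n. \<exists>c. \<forall>t>0. P t = (\<Sum>k\<le>n. c k * B k t)) \<and>
     (\<forall>c. (\<forall>t>0. (\<Sum>k\<le>n. c k * B k t) = 0) \<longrightarrow> (\<forall>k\<le>n. c k = 0)) \<and>
     (\<forall>t>0. (\<Sum>k\<le>n. B k t) = 1) \<and>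
     (\<forall>k\<le>n. zero_mult (B k) a k \<and> zero_mult (B k) b (n - k))"

definition CB_basis :: "(nat \<Rightarrow> real) \<Rightarrow> nat \<Rightarrow> real \<Rightarrow> real \<Rightarrow> nat \<Rightarrow> real \<Rightarrow> real" where
  "CB_basis r n a b = (THE B. is_CB_basis r n a b B)"

definition ctrl_pt ::
  "(real \<Rightarrow> real) \<Rightarrow> (nat \<Rightarrow> real) \<Rightarrow> nat \<Rightarrow> real \<Rightarrow> real \<Rightarrow> nat \<Rightarrow> real" where
  "ctrl_pt P r m a b = (THE c. (\<forall>t>0. P t = (\<Sum>i\<le>m. CB_basis r m a b i t * c i)) \<and>
                               (\<forall>i>m. c i = 0))"

end

theory Submission
  imports Defs
begin

text \<open>
  The control points of \<open>t powr r j\<close> over \<open>[a, 1]\<close> are the values \<open>q i (r j)\<close>, where \<open>q i / p i\<close>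
  is the rational interpolant of type \<open>(m - i, i)\<close> of the function \<open>x \<mapsto> a powr x\<close> at the nodes
  \<open>r 0, \<dots>, r m\<close>, normalised by \<open>q i 0 = 1\<close>. Indeed, the control point functional of index \<open>i\<close> can be
  written both in terms of the derivatives up to order \<open>i\<close> at \<open>a\<close>, which map \<open>t powr x\<close> to
  \<open>p i x * a powr x\<close>, and in terms of those up to order \<open>m - i\<close> at \<open>1\<close>, which map it to \<open>q i x\<close>.

  Let \<open>\<rho> = r k / r 1\<close>. The control polygon of the convex curve \<open>(t powr r 1, t powr r k)\<close> is convex, and
  the curve lies above it because the Bernstein basis is positive; hence \<open>q i (r k) \<le> q i (r 1) powr \<rho>\<close>.
  Conversely, removing the last node expresses \<open>q i\<close> as a convex combination of the products
  \<open>\<Prod>l\<in>{j<..m}. 1 - x / r l\<close>, the control points over \<open>[0, 1]\<close>. By the Muntz condition these products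
  are, uniformly in \<open>j\<close>, close to functions \<open>exp (- s x)\<close>, so Jensen's inequality gives
  \<open>q i (r k) \<ge> q i (r 1) powr \<rho> - \<epsilon>\<close>.
\<close>

section \<open>Degree bounds and zeros of exponential polynomials\<close>

text \<open>The strict bound makes \<open>n\<close> the number of free coefficients and covers the
  zero polynomial uniformly. The zero counts below add up these numbers.\<close>

definition deg_less :: "nat \<Rightarrow> real poly \<Rightarrow> bool" where
  "deg_less n p \<longleftrightarrow> (\<forall>j\<ge>n. coeff p j = 0)"

lemma deg_less_0: "deg_less 0 p \<longleftrightarrow> p = 0"
  by (auto simp: deg_less_def poly_eq_iff)

lemma deg_less_mono: "deg_less n p \<Longrightarrow> n \<le> n' \<Longrightarrow> deg_less n' p"
  by (auto simp: deg_less_def)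

lemma deg_less_zero [simp]: "deg_less n 0"
  by (simp add: deg_less_def)

lemma deg_less_const [simp]: "deg_less (Suc n) [:c:]"
  by (auto simp: deg_less_def coeff_pCons split: nat.splits)

lemma deg_less_diff: "deg_less n p \<Longrightarrow> deg_less n q \<Longrightarrow> deg_less n (p - q)"
  by (auto simp: deg_less_def)

lemma deg_less_add: "deg_less n p \<Longrightarrow> deg_less n q \<Longrightarrow> deg_less n (p + q)"
  by (auto simp: deg_less_def)

lemma deg_less_smult: "deg_less n p \<Longrightarrow> deg_less n (smult c p)"
  by (auto simp: deg_less_def)

lemma deg_less_sum: "(\<And>i. i \<in> A \<Longrightarrow> deg_less n (f i)) \<Longrightarrow> deg_less n (sum f A)"
  by (auto simp: deg_less_def coeff_sum)

lemma deg_less_Suc_degree: "deg_less (Suc n) p \<longleftrightarrow> degree p \<le> n"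
  unfolding deg_less_def
  by (metis Suc_le_eq coeff_eq_0 degree_le le_less_trans less_Suc_eq_le not_less_eq_eq order_le_less_trans)

lemma deg_less_drop: "deg_less (Suc n) p \<Longrightarrow> coeff p n = 0 \<Longrightarrow> deg_less n p"
  unfolding deg_less_def by (metis le_antisym not_less_eq_eq)

lemma deg_less_factor:
  assumes "deg_less (Suc n) p" "poly p x = 0"
  obtains g where "p = [:-x, 1:] * g" "deg_less n g"
proof -
  obtain g where g: "p = [:-x, 1:] * g"
    using assms(2) by (auto simp: poly_eq_0_iff_dvd dvd_def)
  have "deg_less n g"
  proof (cases "g = 0")
    case False
    have "degree p = Suc (degree g)"
      unfolding g using False by (subst degree_mult_eq) auto
    moreover have "degree p \<le> n" using assms(1) by (simp add: deg_less_Suc_degree)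
    ultimately show ?thesis
      by (auto simp: deg_less_def intro: coeff_eq_0)
  qed auto
  with g that show ?thesis by blast
qed

lemma deg_less_roots:
  assumes "deg_less n p" "finite S" "card S \<ge> n" "\<And>x. x \<in> S \<Longrightarrow> poly p x = 0"
  shows "p = 0"
proof (rule ccontr)
  assume p: "p \<noteq> 0"
  hence "degree p < n"
    using assms(1) unfolding deg_less_def by (metis leading_coeff_0_iff not_le)
  moreover have "card S \<le> card {x. poly p x = 0}"
    using assms(4) p by (intro card_mono poly_roots_finite) auto
  ultimately show False
    using card_poly_roots_bound[OF p] assms(3) by linarith
qed

text \<open>Points are added from left to right, and Rolle between the two largest ones yields a new
  zero. The clause \<open>x < y\<close> keeps the earlier zeros to the left of the previous largest
  point, so the new zero is distinct from them.\<close>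

lemma rolle_card:
  fixes f f' :: "real \<Rightarrow> real"
  assumes "\<And>x. (f has_real_derivative f' x) (at x)"
    and "finite S" "\<And>x. x \<in> S \<Longrightarrow> f x = 0"
  shows "\<exists>T. finite T \<and> card S \<le> Suc (card T) \<and> (\<forall>x\<in>T. f' x = 0 \<and> (\<exists>y\<in>S. x < y))"
  using assms(2,3)
proof (induction S rule: finite_linorder_max_induct)
  case empty
  then show ?case by auto
next
  case (insert b A)
  from insert obtain T where T: "finite T" "card A \<le> Suc (card T)"
    "\<And>x. x \<in> T \<Longrightarrow> f' x = 0 \<and> (\<exists>y\<in>A. x < y)" by auto
  show ?case
  proof (cases "A = {}")
    case True
    then show ?thesis by (intro exI[of _ "{}"]) auto
  next
    case False
    define M where "M = Max A"
    have M: "M \<in> A" "M < b" "\<And>y. y \<in> A \<Longrightarrow> y \<le> M"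
      using False insert by (auto simp: M_def)
    have diff: "f differentiable at x" for x
      using assms(1) real_differentiable_def by blast
    have "\<exists>z>M. z < b \<and> DERIV f z :> 0"
    proof (rule Rolle)
      show "continuous_on {M..b} f"
        using assms(1) by (meson DERIV_isCont continuous_at_imp_continuous_on)
    qed (use M insert diff in auto)
    then obtain z where z: "M < z" "z < b" "DERIV f z :> 0" by auto
    have "f' z = 0" using z(3) assms(1) DERIV_unique by blast
    moreover have "z \<notin> T" using T(3) M(3) z(1) by force
    moreover have "b \<notin> A" using M insert by auto
    ultimately show ?thesis
      using T z insert.hyps(1) by (intro exI[of _ "insert z T"]) (auto 4 4)
  qed
qed

lemma exp_poly_deriv:
  fixes A :: "real poly"
  shows "((\<lambda>x. poly A x * exp (\<mu> * x)) has_real_derivative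
           poly (pderiv A + smult \<mu> A) x * exp (\<mu> * x)) (at x)"
  by (rule derivative_eq_intros poly_DERIV refl | simp add: algebra_simps)+

lemma deg_less_exp_deriv:
  "deg_less k A \<Longrightarrow> deg_less k (pderiv A + smult \<mu> A)"
  by (auto simp: deg_less_def coeff_pderiv)

text \<open>\<open>pderiv A\<close> has lower degree, so the leading coefficient of \<open>A\<close>
  is only multiplied by \<open>\<mu>\<close>.\<close>

lemma exp_deriv_eq_0:
  assumes "pderiv A + smult \<mu> A = 0" "\<mu> \<noteq> 0"
  shows "A = (0::real poly)"
proof (rule ccontr)
  assume A: "A \<noteq> 0"
  have "coeff (pderiv A + smult \<mu> A) (degree A) = \<mu> * lead_coeff A"
    by (simp add: coeff_pderiv coeff_eq_0)
  with assms A show False by simp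
qed

lemma deg_less_pderiv: "deg_less (Suc n) C \<Longrightarrow> deg_less n (pderiv C)"
  by (auto simp: deg_less_def coeff_pderiv)

text \<open>Differentiation costs one zero, by Rolle, and one coefficient of \<open>C\<close>, while
  the bound for \<open>A\<close> is preserved. Once \<open>A\<close> is known to vanish,
  \<open>C\<close> alone has too many roots.\<close>

lemma exp_poly_zeros2:
  assumes "\<mu> \<noteq> (0::real)" "deg_less k A" "deg_less n C"
    "finite S" "card S \<ge> k + n" "\<And>x. x \<in> S \<Longrightarrow> poly A x * exp (\<mu> * x) + poly C x = 0"
  shows "A = 0 \<and> C = 0"
  using assms(2-)
proof (induction n arbitrary: A C S)
  case 0
  then show ?case using deg_less_roots[of k A S] by (auto simp: deg_less_0)
next
  case (Suc n)
  have "((\<lambda>x. poly A x * exp (\<mu> * x) + poly C x) has_real_derivative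
      poly (pderiv A + smult \<mu> A) x * exp (\<mu> * x) + poly (pderiv C) x) (at x)" for x
    by (intro derivative_intros exp_poly_deriv poly_DERIV)
  from rolle_card[OF this Suc.prems(3,5)] obtain T where T: "finite T" "card S \<le> Suc (card T)"
    "\<And>x. x \<in> T \<Longrightarrow> poly (pderiv A + smult \<mu> A) x * exp (\<mu> * x) + poly (pderiv C) x = 0"
    by auto
  have "pderiv A + smult \<mu> A = 0 \<and> pderiv C = 0"
    using Suc.prems T by (intro Suc.IH[of _ _ T] deg_less_exp_deriv deg_less_pderiv) auto
  hence A: "A = 0" using exp_deriv_eq_0 assms(1) by blast
  then show ?case using deg_less_roots[of "Suc n" C S] Suc.prems by auto
qed

text \<open>The same descent on \<open>C\<close>. When \<open>C\<close> is exhausted, division by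
  \<open>exp (\<nu> * x)\<close> leaves a two-term sum with the nonzero exponent
  \<open>\<mu> - \<nu>\<close>.\<close>

lemma exp_poly_zeros3:
  assumes "\<mu> \<noteq> (0::real)" "\<nu> \<noteq> 0" "\<mu> \<noteq> \<nu>" "deg_less k A" "deg_less j B" "deg_less n C"
    "finite S" "card S \<ge> k + j + n"
    "\<And>x. x \<in> S \<Longrightarrow> poly A x * exp (\<mu> * x) + poly B x * exp (\<nu> * x) + poly C x = 0"
  shows "A = 0 \<and> B = 0 \<and> C = 0"
  using assms(4-)
proof (induction n arbitrary: A B C S)
  case 0
  have "poly A x * exp ((\<mu> - \<nu>) * x) + poly B x = 0" if "x \<in> S" for x
  proof -
    have "(poly A x * exp ((\<mu> - \<nu>) * x) + poly B x) * exp (\<nu> * x) = 0"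
      using 0(6)[OF that] 0(3) by (simp add: deg_less_0 algebra_simps flip: exp_add)
    thus ?thesis by simp
  qed
  then show ?case using exp_poly_zeros2[of "\<mu> - \<nu>" k A j B S] 0 assms(3) by (auto simp: deg_less_0)
next
  case (Suc n)
  have "((\<lambda>x. poly A x * exp (\<mu> * x) + poly B x * exp (\<nu> * x) + poly C x) has_real_derivative
      poly (pderiv A + smult \<mu> A) x * exp (\<mu> * x) + poly (pderiv B + smult \<nu> B) x * exp (\<nu> * x)
      + poly (pderiv C) x) (at x)" for x
    by (intro derivative_intros exp_poly_deriv poly_DERIV)
  from rolle_card[OF this Suc.prems(4,6)] obtain T where T: "finite T" "card S \<le> Suc (card T)"
    "\<And>x. x \<in> T \<Longrightarrow> poly (pderiv A + smult \<mu> A) x * exp (\<mu> * x) +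
       poly (pderiv B + smult \<nu> B) x * exp (\<nu> * x) + poly (pderiv C) x = 0"
    by auto
  have "pderiv A + smult \<mu> A = 0 \<and> pderiv B + smult \<nu> B = 0 \<and> pderiv C = 0"
    using Suc.prems T by (intro Suc.IH[of _ _ _ T] deg_less_exp_deriv deg_less_pderiv) auto
  hence A: "A = 0" "B = 0" using exp_deriv_eq_0 assms(1,2) by blast+
  then show ?case using deg_less_roots[of "Suc n" C S] Suc.prems by auto
qed

section \<open>Rational interpolation of the exponential\<close>

lemma powr_poly_zeros2:
  assumes "0 < a" "a \<noteq> (1::real)" "deg_less k A" "deg_less n C"
    "finite S" "card S \<ge> k + n" "\<And>x. x \<in> S \<Longrightarrow> poly A x * a powr x + poly C x = 0"
  shows "A = 0 \<and> C = 0"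
  using assms by (intro exp_poly_zeros2[of "ln a" k A n C S]) (auto simp: powr_def mult.commute)

lemma powr_poly_zeros3:
  assumes "0 < a" "a \<noteq> (1::real)" "0 < b" "b \<noteq> 1" "a \<noteq> b"
    "deg_less k A" "deg_less j B" "deg_less n C"
    "finite S" "card S \<ge> k + j + n"
    "\<And>x. x \<in> S \<Longrightarrow> poly A x * a powr x + poly B x * b powr x + poly C x = 0"
  shows "A = 0 \<and> B = 0 \<and> C = 0"
  using assms by (intro exp_poly_zeros3[of "ln a" "ln b" k A j B n C S]) (auto simp: powr_def mult.commute)

text \<open>The linearised condition avoids dividing by \<open>p i\<close>. The strict signs say
  that the degrees are exactly \<open>i\<close> and \<open>m - i\<close>; the alternating sign for
  \<open>q i\<close> fixes the sign of the interpolation error beyond the last node.\<close>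

definition interp_fam ::
  "real \<Rightarrow> (nat \<Rightarrow> real) \<Rightarrow> nat \<Rightarrow> (nat \<Rightarrow> real poly) \<Rightarrow> (nat \<Rightarrow> real poly) \<Rightarrow> bool" where
  "interp_fam a r m p q \<longleftrightarrow> (\<forall>i\<le>m.
     deg_less (Suc i) (p i) \<and> coeff (p i) i > 0 \<and>
     deg_less (Suc (m - i)) (q i) \<and> (-1) ^ (m - i) * coeff (q i) (m - i) > 0 \<and>
     poly (q i) (r 0) = 1 \<and>
     (\<forall>l\<le>m. poly (q i) (r l) = poly (p i) (r l) * a powr r l))"

lemma interp_famD:
  assumes "interp_fam a r m p q" "i \<le> m"
  shows "deg_less (Suc i) (p i)" "coeff (p i) i > 0"
    "deg_less (Suc (m - i)) (q i)" "(-1) ^ (m - i) * coeff (q i) (m - i) > 0"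
    "poly (q i) (r 0) = 1"
    "\<And>l. l \<le> m \<Longrightarrow> poly (q i) (r l) = poly (p i) (r l) * a powr r l"
  using assms unfolding interp_fam_def by blast+

lemma powr_times_poly_tendsto_0:
  assumes "0 < a" "a < (1::real)"
  shows "((\<lambda>x. poly p x * a powr x) \<longlongrightarrow> 0) at_top"
proof -
  define c where "c = - ln a"
  have c: "c > 0" using assms by (simp add: c_def)
  have *: "((\<lambda>x. x ^ n * a powr x) \<longlongrightarrow> 0) at_top" for n
  proof -
    have "((\<lambda>x. (c * x) ^ n / exp (c * x)) \<longlongrightarrow> 0) at_top"
      by (rule filterlim_compose[OF tendsto_power_div_exp_0])
        (use c in \<open>simp add: filterlim_tendsto_pos_mult_at_top[OF tendsto_const _ filterlim_ident]\<close>)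
    hence "((\<lambda>x. (1 / c ^ n) * ((c * x) ^ n / exp (c * x))) \<longlongrightarrow> (1 / c ^ n) * 0) at_top"
      by (intro tendsto_intros)
    moreover have "a powr x = inverse (exp (c * x))" for x
      using assms by (simp add: powr_def c_def exp_minus mult.commute)
    hence "(1 / c ^ n) * ((c * x) ^ n / exp (c * x)) = x ^ n * a powr x" for x
      using c by (simp add: power_mult_distrib divide_inverse)
    ultimately show ?thesis by simp
  qed
  have "((\<lambda>x. \<Sum>i\<le>degree p. coeff p i * (x ^ i * a powr x)) \<longlongrightarrow> (\<Sum>i\<le>degree p. coeff p i * 0)) at_top"
    by (intro tendsto_intros *)
  thus ?thesis by (simp add: poly_altdef sum_distrib_right mult.assoc)
qed

lemma continuous_nonzero_same_sign:
  fixes f :: "real \<Rightarrow> real"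
  assumes "connected S" "continuous_on S f" "\<And>x. x \<in> S \<Longrightarrow> f x \<noteq> 0" "x \<in> S" "y \<in> S" "f y > 0"
  shows "f x > 0"
proof (rule ccontr)
  assume "\<not> f x > 0"
  hence "f x < 0" using assms(3)[OF assms(4)] by linarith
  have "connected (f ` S)" using assms(1,2) connected_continuous_image by blast
  hence "0 \<in> f ` S"
    using \<open>f x < 0\<close> assms(4-6) by (meson connectedD_interval imageI less_imp_le)
  thus False using assms(3) by force
qed

text \<open>By the zero count the difference has no zero beyond the last node, so its sign there is that
  of \<open>- q i\<close> at infinity.\<close>
lemma interp_fam_sign:
  assumes "0 < a" "a < 1" "strict_mono r" "interp_fam a r m p q" "i \<le> m" "r m < x"
  shows "(-1) ^ (m - i) * (poly (q i) x - poly (p i) x * a powr x) > 0"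
proof -
  note F = interp_famD[OF assms(4,5)]
  define f where "f = (\<lambda>x. (-1) ^ (m - i) * (poly (q i) x - poly (p i) x * a powr x))"
  have nz: "f y \<noteq> 0" if y: "y > r m" for y
  proof
    assume "f y = 0"
    have y': "y \<notin> r ` {..m}"
    proof
      assume "y \<in> r ` {..m}"
      then obtain l where "l \<le> m" "y = r l" by blast
      with y show False using strict_mono_less[OF assms(3), of m l] by simp
    qed
    have "inj_on r {..m}" using assms(3) by (simp add: strict_mono_imp_inj_on)
    hence card: "card (insert y (r ` {..m})) = Suc (Suc m)"
      using y' by (simp add: card_image)
    \<comment> \<open>The pair has \<open>m + 2\<close> coefficients, and the nodes together with
      \<open>y\<close> give \<open>m + 2\<close> zeros.\<close>
    have "p i = 0 \<and> - q i = 0"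
    proof (rule powr_poly_zeros2)
      show "deg_less (Suc (m - i)) (- q i)" using F(3) by (simp add: deg_less_def)
      show "Suc i + Suc (m - i) \<le> card (insert y (r ` {..m}))"
        using card assms(5) by simp
      show "poly (p i) x * a powr x + poly (- q i) x = 0" if "x \<in> insert y (r ` {..m})" for x
        using that
      proof
        assume "x = y"
        thus ?thesis using \<open>f y = 0\<close> by (simp add: f_def)
      next
        assume "x \<in> r ` {..m}"
        then obtain l where "l \<le> m" "x = r l" by blast
        thus ?thesis using F(6)[of l] by simp
      qed
    qed (use F(1) assms(1,2) in auto)
    with F(2) show False by simp
  qed
  define Q where "Q = smult ((-1) ^ (m - i)) (q i)"
  have lc: "lead_coeff Q > 0"
  proof -
    have "coeff Q (m - i) > 0" using F(4) by (simp add: Q_def)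
    moreover have "degree Q \<le> m - i" using F(3) by (simp add: Q_def deg_less_Suc_degree)
    ultimately show ?thesis
      by (metis le_antisym le_degree less_numeral_extra(3))
  qed
  then obtain N where N: "\<And>x. x \<ge> N \<Longrightarrow> poly Q x \<ge> lead_coeff Q"
    using poly_pinfty_gt_lc[OF lc] by auto
  have "\<forall>\<^sub>F x in at_top. \<bar>poly (p i) x * a powr x\<bar> < lead_coeff Q"
    using tendstoD[OF powr_times_poly_tendsto_0[OF assms(1,2), of "p i"] lc] by simp
  hence "\<forall>\<^sub>F x in at_top. \<bar>poly (p i) x * a powr x\<bar> < lead_coeff Q \<and> x \<ge> N \<and> x > r m"
    by (intro eventually_conj eventually_ge_at_top eventually_gt_at_top)
  then obtain y where y: "\<bar>poly (p i) y * a powr y\<bar> < lead_coeff Q" "y \<ge> N" "y > r m"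
    by (auto simp: eventually_at_top_linorder)
  have "\<bar>(-1) ^ (m - i) * (poly (p i) y * a powr y)\<bar> = \<bar>poly (p i) y * a powr y\<bar>"
    by (simp add: abs_mult)
  hence "f y > 0"
    using N[OF y(2)] y(1) unfolding f_def Q_def by (simp add: right_diff_distrib)
  moreover have "continuous_on {r m<..} f"
    unfolding f_def using assms(1) by (intro continuous_intros) auto
  ultimately have "f x > 0"
    using nz y(3) assms(6)
    by (intro continuous_nonzero_same_sign[of "{r m<..}" f x y]) auto
  thus ?thesis by (simp add: f_def)
qed

lemma coeff_prod_linear:
  fixes r :: "nat \<Rightarrow> real"
  shows "deg_less (Suc n) (\<Prod>l<n. [:- r l, 1:]) \<and> coeff (\<Prod>l<n. [:- r l, 1:]) n = 1"
proof -
  have d: "degree (\<Prod>l<n. [:- r l, 1:]) = n"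
    by (subst degree_prod_eq_sum_degree) auto
  moreover have "lead_coeff (\<Prod>l<n. [:- r l, 1:]) = 1"
    by (simp add: lead_coeff_prod)
  ultimately show ?thesis by (simp add: deg_less_Suc_degree)
qed

text \<open>Elevation: the pairs \<open>i - 1\<close> and \<open>i\<close> for the first \<open>m + 1\<close> nodes are combined so that the
  condition at the new node holds; the sign lemma makes this a convex combination. The two extreme
  pairs are corrected by a multiple of the node polynomial instead.\<close>
lemma interp_fam_exists:
  assumes "0 < a" "a < 1" "strict_mono r"
  shows "\<exists>p q. interp_fam a r m p q"
proof (induction m)
  case 0
  show ?case
    by (rule exI[of _ "\<lambda>_. [:a powr - r 0:]"], rule exI[of _ "\<lambda>_. 1"])
      (use assms in \<open>auto simp: interp_fam_def powr_minus deg_less_Suc_degree\<close>)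
next
  case (Suc m)
  then obtain p q where F: "interp_fam a r m p q" by blast
  define R where "R = r (Suc m)"
  define D where "D i = poly (q i) R - poly (p i) R * a powr R" for i
  have R: "r m < R" using assms(3) by (simp add: R_def strict_mono_less)
  have D: "(-1) ^ (m - i) * D i > 0" if "i \<le> m" for i
    using interp_fam_sign[OF assms F that R] by (simp add: D_def)
  define W where "W = (\<Prod>l<Suc m. [:- r l, 1:])"
  have W: "deg_less (Suc (Suc m)) W" "coeff W (Suc m) = 1"
    using coeff_prod_linear[of "Suc m" r] by (auto simp: W_def)
  have W0: "poly W (r l) = 0" if "l \<le> m" for l
    unfolding W_def poly_prod using that by (intro prod_zero) auto
  have WR: "poly W R > 0"
    unfolding W_def poly_prod using assms(3)
    by (intro prod_pos) (auto simp: R_def strict_mono_less)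
  \<comment> \<open>The weight cancels the residuals \<open>D\<close> at the new node. Neighbouring
    residuals have opposite signs, so it lies strictly between 0 and 1. It is used only for
    \<open>1 \<le> i \<le> m\<close>.\<close>
  define w where "w i = D (i - 1) / (D (i - 1) - D i)" for i
  have w: "0 < w i" "w i < 1" "(1 - w i) * D (i - 1) + w i * D i = 0" if "1 \<le> i" "i \<le> m" for i
  proof -
    have "m - (i - 1) = Suc (m - i)" using that by simp
    hence "(-1) ^ (m - i) * D (i - 1) < 0" "(-1) ^ (m - i) * D i > 0"
      using D[of "i - 1"] D[of i] that by auto
    hence "D (i - 1) < 0 \<and> D i > 0 \<or> D (i - 1) > 0 \<and> D i < 0"
      by (cases "even (m - i)") auto
    thus "0 < w i" "w i < 1" "(1 - w i) * D (i - 1) + w i * D i = 0"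
      by (auto simp: w_def field_simps)
  qed
  \<comment> \<open>\<open>W\<close> vanishes at every old node, so adding a multiple of it to one
    member of an extreme pair keeps the old conditions and the normalisation at \<open>r 0\<close>.
    It also supplies the leading coefficient of the raised degree.\<close>
  define p' where "p' i = (if i = 0 then p 0 else if i \<le> m then smult (1 - w i) (p (i - 1)) + smult (w i) (p i)
     else p m + smult (D m / (poly W R * a powr R)) W)" for i
  define q' where "q' i = (if i = 0 then q 0 - smult (D 0 / poly W R) W
     else if i \<le> m then smult (1 - w i) (q (i - 1)) + smult (w i) (q i)
     else q m)" for i
  have ap: "a powr x > 0" for x using assms(1) by simp
  have "interp_fam a r (Suc m) p' q'"
    unfolding interp_fam_def
  proof (intro allI impI)
    fix i assume i: "i \<le> Suc m"
    consider "i = 0" | "1 \<le> i" "i \<le> m" | "i = Suc m" using i by linarith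
    then show "deg_less (Suc i) (p' i) \<and> coeff (p' i) i > 0 \<and>
     deg_less (Suc (Suc m - i)) (q' i) \<and> (-1) ^ (Suc m - i) * coeff (q' i) (Suc m - i) > 0 \<and>
     poly (q' i) (r 0) = 1 \<and>
     (\<forall>l\<le>Suc m. poly (q' i) (r l) = poly (p' i) (r l) * a powr r l)"
    proof cases
      case 1
      note F0 = interp_famD[OF F, of 0]
      have "coeff (q 0) (Suc m) = 0" using F0(3) by (simp add: deg_less_def)
      hence "(-1) ^ (Suc m) * coeff (q' 0) (Suc m) > 0"
        using D[of 0] W(2) WR by (simp add: q'_def zero_less_divide_iff field_simps)
      moreover have "deg_less (Suc (Suc m)) (q' 0)"
        using F0(3) W(1) by (auto simp: q'_def intro!: deg_less_diff deg_less_smult elim: deg_less_mono)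
      moreover have "poly (q' 0) (r l) = poly (p' 0) (r l) * a powr r l" if "l \<le> Suc m" for l
      proof (cases "l = Suc m")
        case True
        then show ?thesis using WR by (simp add: q'_def p'_def D_def flip: R_def)
      next
        case False
        then show ?thesis using that F0(6)[of l] W0[of l] by (simp add: q'_def p'_def)
      qed
      moreover have "poly (q' 0) (r 0) = 1" using F0(5) W0[of 0] by (simp add: q'_def)
      ultimately show ?thesis using 1 F0 by (simp add: p'_def)
    next
      case 2
      note G = interp_famD[OF F, of "i - 1"] and H = interp_famD[OF F, of i]
      have pq: "p' i = smult (1 - w i) (p (i - 1)) + smult (w i) (p i)"
        "q' i = smult (1 - w i) (q (i - 1)) + smult (w i) (q i)"
        using 2 by (auto simp: p'_def q'_def)
      have ii: "Suc (i - 1) = i" "m - (i - 1) = Suc m - i" "Suc (m - i) = Suc m - i" using 2 by auto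
      have "coeff (p (i - 1)) i = 0" using G(1) 2 ii by (simp add: deg_less_def)
      hence "coeff (p' i) i > 0" using H(2) 2 w[of i] by (simp add: pq)
      moreover have "deg_less (Suc i) (p' i)" unfolding pq
        using G(1) H(1) 2 ii by (intro deg_less_add deg_less_smult) (auto intro: deg_less_mono[of i])
      moreover have "(-1) ^ (Suc m - i) * coeff (q' i) (Suc m - i) > 0"
      proof -
        have "coeff (q i) (Suc m - i) = 0" using H(3) 2 ii by (simp add: deg_less_def)
        hence "(-1) ^ (Suc m - i) * coeff (q' i) (Suc m - i) =
            (1 - w i) * ((-1) ^ (Suc m - i) * coeff (q (i - 1)) (Suc m - i))"
          by (simp add: pq)
        moreover have "(1 - w i) * ((-1) ^ (Suc m - i) * coeff (q (i - 1)) (Suc m - i)) > 0"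
          using G(4) 2 w[of i] ii by - (rule mult_pos_pos, auto)
        ultimately show ?thesis by (simp only:)
      qed
      moreover have "deg_less (Suc (Suc m - i)) (q' i)" unfolding pq
        using G(3) H(3) 2 ii
        by (intro deg_less_add deg_less_smult) (auto intro: deg_less_mono[of "Suc m - i"])
      moreover have "poly (q' i) (r 0) = 1" using G(5) H(5) 2 by (simp add: pq)
      moreover have "poly (q' i) (r l) = poly (p' i) (r l) * a powr r l" if l: "l \<le> Suc m" for l
      proof (cases "l = Suc m")
        case True
        then show ?thesis using w(3)[OF 2] by (simp add: pq D_def algebra_simps flip: R_def)
      next
        case False
        then show ?thesis using l 2 G(6)[of l] H(6)[of l] by (simp add: pq algebra_simps)
      qed
      ultimately show ?thesis by blast
    next
      case 3
      note F0 = interp_famD[OF F, of m]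
      have "coeff (p m) (Suc m) = 0" using F0(1) by (simp add: deg_less_def)
      hence "coeff (p' i) i > 0"
        using D[of m] W(2) WR ap 3 by (simp add: p'_def)
      moreover have "deg_less (Suc (Suc m)) (p' (Suc m))"
        using F0(1) W(1) by (auto simp: p'_def intro!: deg_less_add deg_less_smult elim: deg_less_mono)
      moreover have "poly (q' i) (r l) = poly (p' i) (r l) * a powr r l" if "l \<le> Suc m" for l
      proof (cases "l = Suc m")
        case True
        then show ?thesis using 3 WR ap[of R] by (simp add: q'_def p'_def D_def field_simps flip: R_def)
      next
        case False
        then show ?thesis using 3 that F0(6)[of l] W0[of l] by (simp add: q'_def p'_def)
      qed
      ultimately show ?thesis using 3 F0 by (simp add: q'_def)
    qed
  qed
  thus ?case by blast
qed

text \<open>Subtracting a multiple of \<open>(p i, q i)\<close> that cancels the top coefficient of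
  \<open>g\<close> leaves a pair with \<open>m + 1\<close> coefficients and \<open>m + 1\<close>
  zeros, hence nothing. The pair \<open>(g, h)\<close> need not be normalised; the factor is read
  off at \<open>r 0\<close>.\<close>

lemma interp_fam_unique:
  assumes "0 < a" "a < 1" "strict_mono r" "interp_fam a r m p q" "i \<le> m"
    and "deg_less (Suc (m - i)) g" "deg_less (Suc i) h"
    and "\<And>l. l \<le> m \<Longrightarrow> poly g (r l) = poly h (r l) * a powr r l"
  shows "g = smult (poly g (r 0)) (q i)"
proof -
  note F = interp_famD[OF assms(4,5)]
  define x where "x = coeff g (m - i) / coeff (q i) (m - i)"
  have "coeff (q i) (m - i) \<noteq> 0" using F(4) by auto
  hence *: "deg_less (m - i) (g - smult x (q i))"
    by (intro deg_less_drop[OF deg_less_diff[OF assms(6) deg_less_smult[OF F(3)]]])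
      (simp add: x_def)
  have "inj_on r {..m}" using assms(3) by (simp add: strict_mono_imp_inj_on)
  hence card: "card (r ` {..m}) = Suc m" by (simp add: card_image)
  have "h - smult x (p i) = 0 \<and> - (g - smult x (q i)) = 0"
  proof (rule powr_poly_zeros2)
    show "deg_less (Suc i) (h - smult x (p i))"
      using F(1) assms(7) by (intro deg_less_diff deg_less_smult)
    show "deg_less (m - i) (- (g - smult x (q i)))" using * by (simp add: deg_less_def)
    show "Suc i + (m - i) \<le> card (r ` {..m})" using card assms(5) by simp
    show "poly (h - smult x (p i)) y * a powr y + poly (- (g - smult x (q i))) y = 0"
      if "y \<in> r ` {..m}" for y
    proof -
      from that obtain l where l: "l \<le> m" "y = r l" by blast
      show ?thesis using F(6)[OF l(1)] assms(8)[OF l(1)] unfolding l(2) by (simp add: algebra_simps)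
    qed
  qed (use assms(1,2) in auto)
  hence "g = smult x (q i)" by simp
  thus ?thesis using F(5) by simp
qed

section \<open>Dual bases and moments\<close>

text \<open>The top coefficient is peeled off repeatedly. The last clause records the coefficient of
  the top element, whose sign decides the positivity of the basis later.\<close>

lemma graded_expand:
  assumes "\<And>j. j < n \<Longrightarrow> deg_less (Suc j) (e j) \<and> coeff (e j) j \<noteq> 0" "deg_less n p"
  shows "\<exists>x. p = (\<Sum>j<n. smult (x j) (e j)) \<and> (\<forall>k. n = Suc k \<longrightarrow> x k = coeff p k / coeff (e k) k)"
  using assms
proof (induction n arbitrary: p)
  case 0
  then show ?case by (simp add: deg_less_0)
next
  case (Suc n)
  define y where "y = coeff p n / coeff (e n) n"
  have e: "deg_less (Suc n) (e n)" "coeff (e n) n \<noteq> 0" using Suc.prems(1)[of n] by auto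
  have "deg_less n (p - smult y (e n))"
    by (rule deg_less_drop[OF deg_less_diff[OF Suc.prems(2) deg_less_smult[OF e(1)]]])
      (use e(2) in \<open>simp add: y_def\<close>)
  from Suc.IH[OF _ this] Suc.prems(1) obtain x
    where x: "p - smult y (e n) = (\<Sum>j<n. smult (x j) (e j))" by auto
  have "(\<Sum>j<n. smult ((x(n := y)) j) (e j)) = (\<Sum>j<n. smult (x j) (e j))"
    by (intro sum.cong) auto
  with x have "p = (\<Sum>j<Suc n. smult ((x(n := y)) j) (e j))"
    by (simp add: algebra_simps)
  thus ?case by (intro exI[of _ "x(n := y)"]) (simp add: y_def)
qed

lemma graded_indep:
  assumes "\<And>j. j < n \<Longrightarrow> deg_less (Suc j) (e j) \<and> coeff (e j) j \<noteq> 0"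
    "(\<Sum>j<n. smult (x j) (e j)) = 0" "j < n"
  shows "x j = 0"
  using assms
proof (induction n arbitrary: j)
  case (Suc n)
  have "deg_less n (e j)" if "j < n" for j
    using deg_less_mono[of "Suc j" "e j" n] Suc.prems(1) that by auto
  hence "deg_less n (\<Sum>j<n. smult (x j) (e j))"
    by (intro deg_less_sum deg_less_smult) auto
  hence "coeff (\<Sum>j<n. smult (x j) (e j)) n = 0" by (simp add: deg_less_def)
  with arg_cong[OF Suc.prems(2), of "\<lambda>p. coeff p n"] have "x n * coeff (e n) n = 0" by simp
  hence xn: "x n = 0" using Suc.prems(1)[of n] by simp
  with Suc.IH[of j] Suc.prems show ?case by (cases "j = n") auto
qed simp

lemma lagrange_basis:
  fixes r :: "nat \<Rightarrow> real"
  assumes "strict_mono r" "l \<le> m"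
  obtains L where "deg_less (Suc m) L" "\<And>j. j \<le> m \<Longrightarrow> poly L (r j) = (if j = l then 1 else 0)"
proof -
  define W where "W = (\<Prod>j\<in>{..m}-{l}. [:- r j, 1:])"
  have "degree W = m" unfolding W_def
    using assms(2) by (subst degree_prod_eq_sum_degree) auto
  hence 1: "deg_less (Suc m) (smult (1 / poly W (r l)) W)"
    by (intro deg_less_smult) (simp add: deg_less_Suc_degree)
  have "poly W (r l) \<noteq> 0"
    unfolding W_def poly_prod using strict_mono_eq[OF assms(1)] by auto
  moreover have "poly W (r j) = 0" if "j \<le> m" "j \<noteq> l" for j
    unfolding W_def poly_prod using that by (intro prod_zero) auto
  ultimately have "poly (smult (1 / poly W (r l)) W) (r j) = (if j = l then 1 else 0)"
    if "j \<le> m" for j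
    using that by auto
  with 1 that show ?thesis by blast
qed

text \<open>\<open>q (m - j)\<close> has exact degree \<open>j\<close>, so reversing the index gives
  a graded family, and a combination with \<open>m + 1\<close> coefficients that vanishes at
  \<open>m + 1\<close> nodes is zero.\<close>

lemma interp_fam_q_indep:
  assumes "strict_mono r" "interp_fam a r m p q"
    and "\<And>l. l \<le> m \<Longrightarrow> (\<Sum>k\<le>m. x k * poly (q k) (r l)) = 0" "k \<le> m"
  shows "x k = 0"
proof -
  have d: "deg_less (Suc j) (q (m - j)) \<and> coeff (q (m - j)) j \<noteq> 0" if "j < Suc m" for j
    using interp_famD(3,4)[OF assms(2), of "m - j"] that by auto
  have rw: "(\<Sum>j<Suc m. smult (x (m - j)) (q (m - j))) = (\<Sum>k\<le>m. smult (x k) (q k))"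
    by (rule sum.reindex_bij_witness[of _ "\<lambda>k. m - k" "\<lambda>k. m - k"]) auto
  have "(\<Sum>k\<le>m. smult (x k) (q k)) = 0"
  proof (rule deg_less_roots[of "Suc m" _ "r ` {..m}"])
    have "deg_less (Suc m) (q k)" if "k \<le> m" for k
      using deg_less_mono[OF interp_famD(3)[OF assms(2) that], of "Suc m"] by simp
    thus "deg_less (Suc m) (\<Sum>k\<le>m. smult (x k) (q k))"
      by (intro deg_less_sum deg_less_smult) auto
    show "Suc m \<le> card (r ` {..m})"
      using assms(1) by (simp add: card_image strict_mono_imp_inj_on)
  qed (use assms(3) in \<open>auto simp: poly_sum\<close>)
  from graded_indep[OF d this[folded rw], of "m - k"] show ?thesis using assms(4) by simp
qed

text \<open>\<open>c\<close> is the inverse of the matrix \<open>poly (q k) (r j)\<close>: expanding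
  Lagrange polynomials in the \<open>q k\<close> gives a one-sided inverse, and independence of the
  \<open>q k\<close> makes it two-sided. \<open>c k l\<close> becomes the coefficient of
  \<open>t powr r l\<close> in the basis function of index \<open>k\<close>.\<close>

lemma interp_fam_dual:
  assumes "strict_mono r" "interp_fam a r m p q"
  shows "\<exists>c. (\<forall>j\<le>m. \<forall>l\<le>m. (\<Sum>k\<le>m. c k l * poly (q k) (r j)) = (if j = l then 1 else 0)) \<and>
    (\<forall>i\<le>m. \<forall>k\<le>m. (\<Sum>l\<le>m. c k l * poly (q i) (r l)) = (if i = k then 1 else 0))"
proof -
  have d: "deg_less (Suc j) (q (m - j)) \<and> coeff (q (m - j)) j \<noteq> 0" if "j < Suc m" for j
    using interp_famD(3,4)[OF assms(2), of "m - j"] that by auto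
  have "\<exists>y. \<forall>j\<le>m. (\<Sum>k\<le>m. y k * poly (q k) (r j)) = (if j = l then 1 else 0)" if l: "l \<le> m" for l
  proof -
    obtain L where L: "deg_less (Suc m) L" "\<And>j. j \<le> m \<Longrightarrow> poly L (r j) = (if j = l then 1 else 0)"
      using lagrange_basis[OF assms(1) l] by blast
    from graded_expand[OF d L(1)] obtain x
      where x: "L = (\<Sum>j<Suc m. smult (x j) (q (m - j)))" by blast
    also have "\<dots> = (\<Sum>k\<le>m. smult (x (m - k)) (q k))"
      by (rule sum.reindex_bij_witness[of _ "\<lambda>k. m - k" "\<lambda>k. m - k"]) auto
    finally have "poly L (r j) = (\<Sum>k\<le>m. x (m - k) * poly (q k) (r j))" for j
      by (simp add: poly_sum)
    thus ?thesis using L(2) by (intro exI[of _ "\<lambda>k. x (m - k)"]) auto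
  qed
  then obtain c' where c': "\<And>l j. l \<le> m \<Longrightarrow> j \<le> m \<Longrightarrow>
      (\<Sum>k\<le>m. c' l k * poly (q k) (r j)) = (if j = l then 1 else 0)" by metis
  define c where "c k l = c' l k" for k l
  have 1: "(\<Sum>k\<le>m. c k l * poly (q k) (r j)) = (if j = l then 1 else 0)" if "j \<le> m" "l \<le> m" for j l
    using c' that by (simp add: c_def)
  have 2: "(\<Sum>l\<le>m. c k l * poly (q i) (r l)) = (if i = k then 1 else 0)" if "i \<le> m" "k \<le> m" for i k
  proof -
    have "(\<Sum>k\<le>m. ((\<Sum>l\<le>m. c k l * poly (q i) (r l)) - (if i = k then 1 else 0)) * poly (q k) (r j)) = 0"
      if j: "j \<le> m" for j
    proof -
      have "(\<Sum>k\<le>m. (\<Sum>l\<le>m. c k l * poly (q i) (r l)) * poly (q k) (r j)) =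
          (\<Sum>l\<le>m. poly (q i) (r l) * (\<Sum>k\<le>m. c k l * poly (q k) (r j)))"
        unfolding sum_distrib_left sum_distrib_right by (subst sum.swap) (simp add: algebra_simps)
      also have "\<dots> = (\<Sum>l\<le>m. if l = j then poly (q i) (r l) else 0)"
        using 1 j by (intro sum.cong) auto
      also have "\<dots> = poly (q i) (r j)" using j by simp
      moreover have "(\<Sum>k\<le>m. (if i = k then 1 else 0) * poly (q k) (r j)) =
          (\<Sum>k\<le>m. if k = i then poly (q k) (r j) else 0)"
        by (intro sum.cong) auto
      ultimately show ?thesis using \<open>i \<le> m\<close> by (simp add: left_diff_distrib sum_subtractf)
    qed
    from interp_fam_q_indep[OF assms this that(2)] show ?thesis by simp
  qed
  from 1 2 show ?thesis by blast
qed

section \<open>Falling factorials, higher derivatives and moments\<close>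

fun ff_poly :: "nat \<Rightarrow> real poly" where
  "ff_poly 0 = 1"
| "ff_poly (Suc j) = [:- real j, 1:] * ff_poly j"

lemma ff_poly_deg: "deg_less (Suc j) (ff_poly j) \<and> coeff (ff_poly j) j = 1"
proof (induction j)
  case 0
  then show ?case by (simp add: deg_less_Suc_degree)
next
  case (Suc j)
  have "deg_less (Suc (Suc j)) (ff_poly (Suc j))"
    unfolding deg_less_def
  proof (intro allI impI)
    fix i assume "Suc (Suc j) \<le> i"
    then obtain i' where "i = Suc i'" "Suc j \<le> i'" using Suc_le_D by (metis Suc_le_mono)
    thus "coeff (ff_poly (Suc j)) i = 0" using Suc by (simp add: deg_less_def)
  qed
  thus ?case using Suc by (simp add: deg_less_def)
qed

lemma powr_sum_has_derivative:
  assumes "x > 0"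
  shows "((\<lambda>t. \<Sum>l\<le>m. e l * poly (ff_poly j) (r l) * t powr (r l - real j)) has_real_derivative
    (\<Sum>l\<le>m. e l * poly (ff_poly (Suc j)) (r l) * x powr (r l - real (Suc j)))) (at x)"
  by (rule derivative_eq_intros refl has_real_derivative_powr assms)+
    (auto intro!: sum.cong simp: algebra_simps)

lemma higher_deriv_powr_sum:
  assumes "\<And>t. t > 0 \<Longrightarrow> f t = (\<Sum>l\<le>m. e l * t powr r l)" "x > 0"
  shows "(deriv ^^ j) f x = (\<Sum>l\<le>m. e l * poly (ff_poly j) (r l) * x powr (r l - real j))"
  using assms(2)
proof (induction j arbitrary: x)
  case 0
  then show ?case using assms(1) by simp
next
  case (Suc j)
  have "\<forall>\<^sub>F t in nhds x. t \<in> {0<..}" using Suc.prems by (intro eventually_nhds_in_open) auto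
  hence "\<forall>\<^sub>F t in nhds x. (deriv ^^ j) f t = (\<Sum>l\<le>m. e l * poly (ff_poly j) (r l) * t powr (r l - real j))"
    by eventually_elim (use Suc.IH in auto)
  hence "deriv ((deriv ^^ j) f) x = deriv (\<lambda>t. \<Sum>l\<le>m. e l * poly (ff_poly j) (r l) * t powr (r l - real j)) x"
    by (intro deriv_cong_ev) auto
  also have "\<dots> = (\<Sum>l\<le>m. e l * poly (ff_poly (Suc j)) (r l) * x powr (r l - real (Suc j)))"
    by (rule DERIV_imp_deriv[OF powr_sum_has_derivative[OF Suc.prems]])
  finally show ?case by simp
qed

text \<open>For \<open>x > 0\<close> this is \<open>P(t d/dt)\<close> applied at \<open>x\<close> to
  the function with coefficients \<open>e\<close>, because \<open>t powr r l\<close> is an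
  eigenfunction of \<open>t d/dt\<close> with eigenvalue \<open>r l\<close>.\<close>

definition moment :: "(nat \<Rightarrow> real) \<Rightarrow> nat \<Rightarrow> (nat \<Rightarrow> real) \<Rightarrow> real \<Rightarrow> real poly \<Rightarrow> real" where
  "moment r m e x P = (\<Sum>l\<le>m. e l * poly P (r l) * x powr r l)"

lemma moment_lincomb:
  "moment r m e x (\<Sum>j\<in>A. smult (y j) (P j)) = (\<Sum>j\<in>A. y j * moment r m e x (P j))"
  unfolding moment_def poly_sum poly_smult sum_distrib_left sum_distrib_right
  by (subst sum.swap) (simp add: algebra_simps)

lemma higher_deriv_moment:
  assumes "\<And>t. t > 0 \<Longrightarrow> f t = (\<Sum>l\<le>m. e l * t powr r l)" "x > 0"
  shows "(deriv ^^ j) f x = moment r m e x (ff_poly j) / x ^ j"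
  using higher_deriv_powr_sum[OF assms] assms(2)
  by (simp add: moment_def powr_diff powr_realpow sum_divide_distrib)

lemma moment_graded_eq_0:
  assumes "\<And>j. j < n \<Longrightarrow> deg_less (Suc j) (E j) \<and> coeff (E j) j \<noteq> 0"
    "\<And>j. j < n \<Longrightarrow> moment r m e x (E j) = 0" "deg_less n P"
  shows "moment r m e x P = 0"
proof -
  from graded_expand[OF assms(1,3)] obtain y where "P = (\<Sum>j<n. smult (y j) (E j))" by blast
  thus ?thesis using assms(2) by (simp add: moment_lincomb)
qed

lemma zero_mult_moment:
  assumes "\<And>t. t > 0 \<Longrightarrow> f t = (\<Sum>l\<le>m. e l * t powr r l)" "x > 0"
    "zero_mult f x k" "deg_less k P"
  shows "moment r m e x P = 0"
proof (rule moment_graded_eq_0[of k ff_poly])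
  show "moment r m e x (ff_poly j) = 0" if "j < k" for j
    using assms(2,3) that higher_deriv_moment[OF assms(1,2), of j] by (simp add: zero_mult_def)
qed (use ff_poly_deg assms(4) in auto)

text \<open>The falling factorials may be exchanged for any graded family, since both span the
  polynomials below each degree. This allows testing with the \<open>p j\<close> at \<open>a\<close>
  and with the \<open>q j\<close> at 1.\<close>

lemma zero_multI:
  assumes "\<And>t. t > 0 \<Longrightarrow> f t = (\<Sum>l\<le>m. e l * t powr r l)" "x > 0"
    "\<And>j. j < Suc k \<Longrightarrow> deg_less (Suc j) (E j) \<and> coeff (E j) j \<noteq> 0"
    "\<And>j. j < k \<Longrightarrow> moment r m e x (E j) = 0" "moment r m e x (E k) \<noteq> 0"
  shows "zero_mult f x k"
proof -
  have z: "moment r m e x (ff_poly j) = 0" if "j < k" for j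
    by (rule moment_graded_eq_0[of k E])
      (use assms(3,4) deg_less_mono[of "Suc j" "ff_poly j" k] ff_poly_deg[of j] that in auto)
  moreover have "moment r m e x (ff_poly k) \<noteq> 0"
  proof
    assume "moment r m e x (ff_poly k) = 0"
    with z have "moment r m e x (ff_poly j) = 0" if "j < Suc k" for j
      using that by (cases "j = k") auto
    hence "moment r m e x (E k) = 0"
      by (rule moment_graded_eq_0[of "Suc k" ff_poly, rotated]) (use assms(3) ff_poly_deg in auto)
    with assms(5) show False by simp
  qed
  ultimately show ?thesis
    using assms(2) by (simp add: zero_mult_def higher_deriv_moment[OF assms(1,2)])
qed

text \<open>All derivatives at 1 vanish, hence all moments there, and the moment of a Lagrange
  polynomial isolates \<open>e l\<close>.\<close>

lemma powr_indep:
  fixes r e :: "nat \<Rightarrow> real"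
  assumes "strict_mono r" "\<And>t. t > 0 \<Longrightarrow> (\<Sum>l\<le>m. e l * t powr r l) = 0" "l \<le> m"
  shows "e l = 0"
proof -
  have d: "(deriv ^^ j) (\<lambda>_. 0 :: real) = (\<lambda>_. 0)" for j
    by (induction j) auto
  have z: "moment r m e 1 (ff_poly j) = 0" for j
    using higher_deriv_moment[where f = "\<lambda>_. 0" and m = m and e = e and r = r and x = 1 and j = j] assms(2) by (simp add: d)
  obtain L where L: "deg_less (Suc m) L" "\<And>j. j \<le> m \<Longrightarrow> poly L (r j) = (if j = l then 1 else 0)"
    using lagrange_basis[OF assms(1,3)] by blast
  have "moment r m e 1 L = 0"
    by (rule moment_graded_eq_0[OF _ z L(1)]) (use ff_poly_deg in auto)
  moreover have "moment r m e 1 L = (\<Sum>j\<le>m. if j = l then e j else 0)"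
    unfolding moment_def using L(2) by (intro sum.cong) auto
  ultimately show ?thesis using assms(3) by simp
qed

section \<open>The Chebyshev-Bernstein basis\<close>

locale interp_basis =
  fixes a :: real and r :: "nat \<Rightarrow> real" and m :: nat
    and p q :: "nat \<Rightarrow> real poly" and c :: "nat \<Rightarrow> nat \<Rightarrow> real"
  assumes a: "0 < a" "a < 1" and r: "strict_mono r" and r0: "r 0 = 0"
    and fam: "interp_fam a r m p q"
    and dual1: "\<And>j l. j \<le> m \<Longrightarrow> l \<le> m \<Longrightarrow>
      (\<Sum>k\<le>m. c k l * poly (q k) (r j)) = (if j = l then 1 else 0)"
    and dual2: "\<And>i k. i \<le> m \<Longrightarrow> k \<le> m \<Longrightarrow>
      (\<Sum>l\<le>m. c k l * poly (q i) (r l)) = (if i = k then 1 else 0)"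
begin

text \<open>The value 0 beyond \<open>m\<close> follows the convention in
  \<open>is_CB_basis\<close>, so that equality with \<open>CB_basis\<close> holds for whole
  families.\<close>

definition B :: "nat \<Rightarrow> real \<Rightarrow> real" where
  "B k t = (if k \<le> m then \<Sum>l\<le>m. c k l * t powr r l else 0)"

lemma B_eq: "k \<le> m \<Longrightarrow> B k t = (\<Sum>l\<le>m. c k l * t powr r l)"
  by (simp add: B_def)

lemma sum_B:
  "(\<Sum>k\<le>m. x k * B k t) = (\<Sum>l\<le>m. (\<Sum>k\<le>m. x k * c k l) * t powr r l)"
  unfolding sum_distrib_right by (subst sum.swap) (simp add: B_eq sum_distrib_left mult.assoc)

lemma powr_eq_sum_B:
  assumes "j \<le> m"
  shows "t powr r j = (\<Sum>k\<le>m. poly (q k) (r j) * B k t)"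
proof -
  have "(\<Sum>k\<le>m. poly (q k) (r j) * B k t) = (\<Sum>l\<le>m. (if l = j then 1 else 0) * t powr r l)"
    unfolding sum_B using dual1[OF assms] by (intro sum.cong) (auto simp: mult.commute)
  also have "\<dots> = (\<Sum>l\<le>m. if l = j then t powr r l else 0)"
    by (intro sum.cong) auto
  finally show ?thesis using assms by simp
qed

lemma powr_sum_eq_sum_B:
  "(\<Sum>l\<le>m. e l * t powr r l) = (\<Sum>k\<le>m. (\<Sum>l\<le>m. e l * poly (q k) (r l)) * B k t)"
proof -
  have "(\<Sum>l\<le>m. e l * t powr r l) = (\<Sum>l\<le>m. \<Sum>k\<le>m. e l * poly (q k) (r l) * B k t)"
    using powr_eq_sum_B by (intro sum.cong) (auto simp: sum_distrib_left mult.assoc)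
  also have "\<dots> = (\<Sum>k\<le>m. (\<Sum>l\<le>m. e l * poly (q k) (r l)) * B k t)"
    by (subst sum.swap) (simp add: sum_distrib_right)
  finally show ?thesis .
qed

lemma B_indep:
  assumes "\<And>t. t > 0 \<Longrightarrow> (\<Sum>k\<le>m. x k * B k t) = 0" "i \<le> m"
  shows "x i = 0"
proof -
  have "(\<Sum>k\<le>m. x k * c k l) = 0" if "l \<le> m" for l
    using assms(1) that
    by (intro powr_indep[OF r, where m = m and e = "\<lambda>l. \<Sum>k\<le>m. x k * c k l"]) (simp_all add: sum_B)
  hence "0 = (\<Sum>l\<le>m. (\<Sum>k\<le>m. x k * c k l) * poly (q i) (r l))" by simp
  also have "\<dots> = (\<Sum>k\<le>m. x k * (\<Sum>l\<le>m. c k l * poly (q i) (r l)))"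
    unfolding sum_distrib_right sum_distrib_left by (subst sum.swap) (simp add: mult.assoc)
  also have "\<dots> = (\<Sum>k\<le>m. if k = i then x k else 0)"
    using dual2 assms(2) by (intro sum.cong) auto
  finally show ?thesis using assms(2) by simp
qed

lemma B_sum_1: "t > 0 \<Longrightarrow> (\<Sum>k\<le>m. B k t) = 1"
  using powr_eq_sum_B[of 0 t] interp_famD(5)[OF fam] by (simp add: r0)

text \<open>The interpolation conditions turn the moment of \<open>p j\<close> at \<open>a\<close>
  into that of \<open>q j\<close> at 1. This common functional reads off the coefficient of
  \<open>B j\<close>.\<close>

lemma moment_a_p: "j \<le> m \<Longrightarrow> moment r m e a (p j) = (\<Sum>l\<le>m. e l * poly (q j) (r l))"
  unfolding moment_def using interp_famD(6)[OF fam] by (intro sum.cong) (auto simp: mult.assoc)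

lemma moment_1_q: "moment r m e 1 (q j) = (\<Sum>l\<le>m. e l * poly (q j) (r l))"
  by (simp add: moment_def)

lemma p_graded: "j \<le> m \<Longrightarrow> deg_less (Suc j) (p j) \<and> coeff (p j) j \<noteq> 0"
  using interp_famD(1,2)[OF fam, of j] by auto

lemma q_graded: "j \<le> m \<Longrightarrow> deg_less (Suc j) (q (m - j)) \<and> coeff (q (m - j)) j \<noteq> 0"
  using interp_famD(3,4)[OF fam, of "m - j"] by auto

text \<open>By \<open>dual2\<close> the moment of \<open>p j\<close> at \<open>a\<close> is 1 for
  \<open>j = k\<close> and 0 otherwise, so the first nonzero order is \<open>k\<close>. At 1 the
  reversed family \<open>q (m - j)\<close> does the same.\<close>

lemma B_zero_mult_a:
  assumes "k \<le> m"
  shows "zero_mult (B k) a k"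
  by (rule zero_multI[where m = m and e = "c k" and r = r and E = p])
    (use assms a p_graded dual2 in \<open>auto simp: B_eq moment_a_p\<close>)

lemma B_zero_mult_1:
  assumes "k \<le> m"
  shows "zero_mult (B k) 1 (m - k)"
  by (rule zero_multI[where m = m and e = "c k" and r = r and E = "\<lambda>j. q (m - j)"])
    (use assms q_graded dual2 in \<open>auto simp: B_eq moment_1_q\<close>)

lemma is_CB_basis_B: "is_CB_basis r m a 1 B"
  unfolding is_CB_basis_def
proof (intro conjI allI impI ballI)
  show "B k \<in> muntz_space r m" if "k \<le> m" for k
    using that by (auto simp: muntz_space_def B_def fun_eq_iff)
  show "B k = (\<lambda>_. 0)" if "k > m" for k
    using that by (auto simp: B_def)
  show "\<exists>c. \<forall>t>0. P t = (\<Sum>k\<le>m. c k * B k t)" if "P \<in> muntz_space r m" for P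
  proof -
    from that obtain e where "P = (\<lambda>t. \<Sum>l\<le>m. e l * t powr r l)"
      by (auto simp: muntz_space_def)
    thus ?thesis by (intro exI[of _ "\<lambda>k. \<Sum>l\<le>m. e l * poly (q k) (r l)"]) (simp add: powr_sum_eq_sum_B)
  qed
qed (use B_indep B_sum_1 B_zero_mult_a B_zero_mult_1 in auto)

text \<open>The functional of index \<open>i\<close> is a moment at \<open>a\<close> for
  \<open>i < k\<close> and a moment at 1 for \<open>i > k\<close>; the prescribed zeros of
  \<open>B' k\<close> make both vanish. So \<open>B' k\<close> is a multiple of \<open>B k\<close>,
  and the partition of unity forces every factor to be 1.\<close>

lemma CB_basis_unique:
  assumes "is_CB_basis r m a 1 B'"
  shows "B' = B"
proof -
  note D = assms[unfolded is_CB_basis_def]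
  have "\<exists>x. \<forall>t. B' k t = x * B k t" if k: "k \<le> m" for k
  proof -
    from D k obtain e where e: "B' k = (\<lambda>t. \<Sum>l\<le>m. e l * t powr r l)"
      by (auto simp: muntz_space_def)
    have "(\<Sum>l\<le>m. e l * poly (q i) (r l)) = 0" if i: "i \<le> m" "i \<noteq> k" for i
    proof (cases "i < k")
      case True
      have "moment r m e a (p i) = 0"
      proof (rule zero_mult_moment)
        show "zero_mult (B' k) a k" using D k by blast
        show "deg_less k (p i)" using p_graded[OF i(1)] True by (auto intro: deg_less_mono[of "Suc i"])
      qed (use e a in auto)
      thus ?thesis using i by (simp add: moment_a_p)
    next
      case False
      have "moment r m e 1 (q i) = 0"
      proof (rule zero_mult_moment)
        show "zero_mult (B' k) 1 (m - k)" using D k by blast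
        show "deg_less (m - k) (q i)"
          using interp_famD(3)[OF fam i(1)] False i
          by (auto intro: deg_less_mono[of "Suc (m - i)"])
      qed (use e in auto)
      thus ?thesis by (simp add: moment_1_q)
    qed
    hence "B' k t = (\<Sum>i\<le>m. if i = k then (\<Sum>l\<le>m. e l * poly (q i) (r l)) * B i t else 0)" for t
      unfolding e powr_sum_eq_sum_B by (intro sum.cong) auto
    thus ?thesis using k by (auto simp: sum.delta)
  qed
  then obtain x where x: "\<And>k t. k \<le> m \<Longrightarrow> B' k t = x k * B k t" by metis
  have "x k - 1 = 0" if k: "k \<le> m" for k
  proof (rule B_indep[OF _ k])
    fix t :: real assume "t > 0"
    hence "(\<Sum>k\<le>m. B' k t) = 1" using D by blast
    moreover have "(\<Sum>k\<le>m. B' k t) = (\<Sum>k\<le>m. x k * B k t)" using x by (intro sum.cong) auto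
    ultimately show "(\<Sum>k\<le>m. (x k - 1) * B k t) = 0"
      using B_sum_1[OF \<open>t > 0\<close>] by (simp add: left_diff_distrib sum_subtractf)
  qed
  hence "B' k t = B k t" for k t
    using x D by (cases "k \<le> m") (auto simp: B_def)
  thus ?thesis by blast
qed

lemma CB_basis_eq: "CB_basis r m a 1 = B"
  unfolding CB_basis_def using is_CB_basis_B CB_basis_unique by (rule the_equality)

lemma ctrl_pt_powr:
  assumes "j \<le> m" "i \<le> m"
  shows "ctrl_pt (\<lambda>t. t powr r j) r m a 1 i = poly (q i) (r j)"
proof -
  define e where "e i = (if i \<le> m then poly (q i) (r j) else 0)" for i
  have "ctrl_pt (\<lambda>t. t powr r j) r m a 1 = e"
    unfolding ctrl_pt_def CB_basis_eq
  proof (rule the_equality)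
    have "t powr r j = (\<Sum>i\<le>m. B i t * e i)" for t
      using powr_eq_sum_B[OF assms(1), of t] by (simp add: e_def mult.commute)
    thus "(\<forall>t>0. t powr r j = (\<Sum>i\<le>m. B i t * e i)) \<and> (\<forall>i>m. e i = 0)"
      by (simp add: e_def)
  next
    fix d assume d: "(\<forall>t>0. t powr r j = (\<Sum>i\<le>m. B i t * d i)) \<and> (\<forall>i>m. d i = 0)"
    have "d i - poly (q i) (r j) = 0" if "i \<le> m" for i
    proof (rule B_indep[OF _ that])
      fix t :: real assume "t > 0"
      with d powr_eq_sum_B[OF assms(1), of t]
      show "(\<Sum>k\<le>m. (d k - poly (q k) (r j)) * B k t) = 0"
        by (simp add: left_diff_distrib sum_subtractf mult.commute[of "B _ _"])
    qed
    thus "d = e" using d by (auto simp: e_def fun_eq_iff)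
  qed
  thus ?thesis using assms by (simp add: e_def)
qed

text \<open>If \<open>B k s = 0\<close>, then at the \<open>m + 1\<close> nodes the function \<open>x \<mapsto> s powr x\<close> agrees with
  \<open>H * a powr x + K\<close> where \<open>H\<close> and \<open>K\<close> have only \<open>m\<close> coefficients in total.\<close>
lemma B_nonzero:
  assumes "k \<le> m" "a < s" "s < 1"
  shows "B k s \<noteq> 0"
proof
  assume z: "B k s = 0"
  define H where "H = (\<Sum>j<k. smult (B j s) (p j))"
  define K where "K = (\<Sum>j\<in>{k<..m}. smult (B j s) (q j))"
  \<comment> \<open>The three terms have \<open>k\<close>, \<open>1\<close> and \<open>m - k\<close>
    coefficients against \<open>m + 1\<close> nodes. The constant \<open>-1\<close> multiplies
    \<open>s powr x\<close>, so its vanishing is the contradiction.\<close>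
  have "H = 0 \<and> [:- 1:] = (0 :: real poly) \<and> K = 0"
  proof (rule powr_poly_zeros3[of a s k H 1 "[:- 1:]" "m - k" K "r ` {..m}"])
    show "deg_less k H" unfolding H_def
    proof (intro deg_less_sum deg_less_smult)
      fix j assume "j \<in> {..<k}"
      thus "deg_less k (p j)" using p_graded[of j] assms(1) deg_less_mono[of "Suc j" "p j" k] by auto
    qed
    show "deg_less (m - k) K" unfolding K_def
    proof (intro deg_less_sum deg_less_smult)
      fix j assume "j \<in> {k<..m}"
      thus "deg_less (m - k) (q j)"
        using interp_famD(3)[OF fam, of j] deg_less_mono[of "Suc (m - j)" "q j" "m - k"] by auto
    qed
    show "k + 1 + (m - k) \<le> card (r ` {..m})"
      using assms(1) r by (simp add: card_image strict_mono_imp_inj_on)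
    show "poly H x * a powr x + poly [:- 1:] x * s powr x + poly K x = 0" if "x \<in> r ` {..m}" for x
    proof -
      from that obtain l where l: "l \<le> m" "x = r l" by blast
      have "{..m} = {..<k} \<union> {k} \<union> {k<..m}" using assms(1) by auto
      hence "s powr r l = (\<Sum>j\<in>{..<k} \<union> {k} \<union> {k<..m}. poly (q j) (r l) * B j s)"
        using powr_eq_sum_B[OF l(1), of s] by simp
      also have "\<dots> = (\<Sum>j<k. poly (q j) (r l) * B j s) + (\<Sum>j\<in>{k<..m}. poly (q j) (r l) * B j s)"
        using z by (subst sum.union_disjoint, simp, simp, force)+ simp
      also have "(\<Sum>j<k. poly (q j) (r l) * B j s) = poly H (r l) * a powr r l"
        unfolding H_def poly_sum sum_distrib_right
        using interp_famD(6)[OF fam _ l(1)] assms(1) by (intro sum.cong) auto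
      also have "(\<Sum>j\<in>{k<..m}. poly (q j) (r l) * B j s) = poly K (r l)"
        unfolding K_def poly_sum by (intro sum.cong) auto
      finally show ?thesis by (simp add: l(2))
    qed
  qed (use a assms in auto)
  thus False by simp
qed

text \<open>Without zeros between \<open>a\<close> and 1, the sign is decided near \<open>a\<close>,
  where Taylor's formula reduces it to the sign of the derivative of order \<open>k\<close>.\<close>

lemma B_pos:
  assumes "k \<le> m" "a < s" "s < 1"
  shows "B k s > 0"
proof -
  define d where "d j t = (\<Sum>l\<le>m. c k l * poly (ff_poly j) (r l) * t powr (r l - real j))" for j t
  have d_deriv: "DERIV (d j) t :> d (Suc j) t" if "t > 0" for j t
    unfolding d_def by (rule powr_sum_has_derivative[OF that])
  have d0: "d 0 = B k" using assms(1) by (auto simp: d_def B_eq)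
  have d_moment: "d j a = moment r m (c k) a (ff_poly j) / a ^ j" for j
    using a by (simp add: d_def moment_def powr_diff powr_realpow sum_divide_distrib)
  have mp: "moment r m (c k) a (p j) = (if j = k then 1 else 0)" if "j \<le> k" for j
    using dual2 assms(1) that by (simp add: moment_a_p)
  have dz: "d j a = 0" if "j < k" for j
  proof -
    have "moment r m (c k) a (ff_poly j) = 0"
      by (rule moment_graded_eq_0[of "Suc j" p])
        (use p_graded assms(1) that mp ff_poly_deg in auto)
    thus ?thesis by (simp add: d_moment)
  qed
  have dk: "d k a > 0"
  proof -
    have "deg_less (Suc k) (ff_poly k)" using ff_poly_deg by blast
    moreover have "deg_less (Suc j) (p j) \<and> coeff (p j) j \<noteq> 0" if "j < Suc k" for j
      using p_graded assms(1) that by simp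
    ultimately obtain y where y: "ff_poly k = (\<Sum>j<Suc k. smult (y j) (p j))"
      "y k = coeff (ff_poly k) k / coeff (p k) k"
      using graded_expand[of "Suc k" p "ff_poly k"] by blast
    \<comment> \<open>Only the top term survives; its coefficient is the inverse of the leading
      coefficient of \<open>p k\<close>.\<close>
    have "moment r m (c k) a (ff_poly k) = (\<Sum>j<Suc k. if j = k then y j else 0)"
      unfolding y(1) moment_lincomb using mp by (intro sum.cong) auto
    hence "moment r m (c k) a (ff_poly k) > 0"
      using y(2) ff_poly_deg[of k] interp_famD(2)[OF fam assms(1)] by simp
    thus ?thesis using a by (simp add: d_moment)
  qed
  have "isCont (d k) a" using d_deriv a DERIV_isCont by blast
  hence "\<forall>\<^sub>F t in at a. d k t > 0"
    using dk by (simp add: isCont_def order_tendsto_iff)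
  hence "\<forall>\<^sub>F t in at_right a. d k t > 0"
    by (simp add: eventually_at_split)
  then obtain b where b: "b > a" "\<And>t. a < t \<Longrightarrow> t < b \<Longrightarrow> d k t > 0"
    by (auto simp: eventually_at_right[OF a(2)])
  \<comment> \<open>A point below 1 and so close to \<open>a\<close> that the derivative of order
    \<open>k\<close> is still positive up to it.\<close>
  define y where "y = min ((a + b) / 2) ((a + 1) / 2)"
  have y: "a < y" "y < b" "y < 1" using a b by (auto simp: y_def min_def field_simps)
  have "B k y > 0"
  proof (cases "k = 0")
    case True
    then show ?thesis using b(2)[OF y(1,2)] d0 by auto
  next
    case False
    hence "\<exists>t>a. t < y \<and> d 0 y = (\<Sum>j<k. d j a / fact j * (y - a) ^ j) + d k t / fact k * (y - a) ^ k"
      using a y d_deriv by (intro Taylor_up[of k d "d 0" a y a]) auto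
    then obtain t where t: "t > a" "t < y" "d 0 y = d k t / fact k * (y - a) ^ k"
      using dz by auto
    have "d k t / fact k * (y - a) ^ k > 0" using b(2)[of t] t y by simp
    thus ?thesis using t(3) d0 by simp
  qed
  moreover have "continuous_on {a<..<1} (B k)"
    using d_deriv[of _ 0] a unfolding d0
    by (intro continuous_at_imp_continuous_on ballI DERIV_isCont) (auto intro: less_trans)
  ultimately show ?thesis
    using B_nonzero[OF assms(1)] assms y
    by (intro continuous_nonzero_same_sign[of "{a<..<1}" "B k" s y]) auto
qed

end

section \<open>Recursions for the control points\<close>

text \<open>Neighbouring pairs agree at \<open>r 0\<close>. Dividing their difference by
  \<open>x - r 0\<close> leaves an interpolating pair of index \<open>i\<close> for the nodes
  without \<open>r 0\<close>, which is unique up to a factor.\<close>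

lemma interp_fam_step:
  assumes "0 < a" "a < 1" "strict_mono r" "interp_fam a r (Suc n) p q"
    "interp_fam a (r \<circ> Suc) n p' q'" "i \<le> n"
  shows "\<exists>d>0. \<forall>x. poly (q (Suc i)) x - poly (q i) x = d * (x - r 0) * poly (q' i) x"
proof -
  have i: "i \<le> Suc n" "Suc i \<le> Suc n" using assms(6) by auto
  note F = interp_famD[OF assms(4) i(1)] and G = interp_famD[OF assms(4) i(2)]
    and F' = interp_famD[OF assms(5,6)]
  have "deg_less (Suc (Suc (n - i))) (q (Suc i) - q i)"
    using F(3) G(3) assms(6) deg_less_mono[of "Suc (n - i)" "q (Suc i)" "Suc (Suc (n - i))"]
    by (intro deg_less_diff) (auto simp: Suc_diff_le)
  moreover have "poly (q (Suc i) - q i) (r 0) = 0" using F(5) G(5) by simp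
  ultimately obtain g where g: "q (Suc i) - q i = [:- r 0, 1:] * g" "deg_less (Suc (n - i)) g"
    by (rule deg_less_factor)
  have "deg_less (Suc (Suc i)) (p (Suc i) - p i)"
    using F(1) G(1) deg_less_mono[of "Suc i" "p i" "Suc (Suc i)"] by (intro deg_less_diff) auto
  moreover have "poly (p (Suc i) - p i) (r 0) * a powr r 0 = 0"
    using F(6)[of 0] G(6)[of 0] F(5) G(5) by (simp add: left_diff_distrib)
  hence "poly (p (Suc i) - p i) (r 0) = 0" using assms(1) by simp
  ultimately obtain h where h: "p (Suc i) - p i = [:- r 0, 1:] * h" "deg_less (Suc i) h"
    by (rule deg_less_factor)
  have gh: "poly g (r (Suc l)) = poly h (r (Suc l)) * a powr r (Suc l)" if "l \<le> n" for l
  proof -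
    have "r (Suc l) - r 0 \<noteq> 0" using strict_mono_eq[OF assms(3)] by simp
    moreover have "poly (q (Suc i) - q i) (r (Suc l)) = poly (p (Suc i) - p i) (r (Suc l)) * a powr r (Suc l)"
      using F(6)[of "Suc l"] G(6)[of "Suc l"] that by (simp add: algebra_simps)
    hence "(r (Suc l) - r 0) * poly g (r (Suc l)) = (r (Suc l) - r 0) * (poly h (r (Suc l)) * a powr r (Suc l))"
      unfolding g(1) h(1) by (simp add: algebra_simps)
    ultimately show ?thesis by (simp only: mult_cancel_left) simp
  qed
  define x where "x = poly g (r (Suc 0))"
  have "strict_mono (r \<circ> Suc)" using assms(3) by (simp add: strict_mono_def)
  from interp_fam_unique[OF assms(1,2) this assms(5,6) g(2) h(2)] gh
  have gx: "g = smult x (q' i)" by (simp add: x_def)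
  \<comment> \<open>\<open>q (Suc i)\<close> has lower degree, so the top coefficient of the
    difference comes from \<open>q i\<close> alone; the sign conditions then give
    \<open>x > 0\<close>.\<close>
  have "coeff (q (Suc i)) (Suc (n - i)) = 0" using G(3) by (simp add: deg_less_def)
  hence "- coeff (q i) (Suc (n - i)) = coeff g (n - i)"
    using arg_cong[OF g(1), of "\<lambda>p. coeff p (Suc (n - i))"] g(2) by (simp add: deg_less_def)
  also have "\<dots> = x * coeff (q' i) (n - i)" by (simp add: gx)
  finally have "coeff (q i) (Suc (n - i)) = - (x * coeff (q' i) (n - i))" by simp
  hence "x * ((-1) ^ (n - i) * coeff (q' i) (n - i)) = (-1) ^ (Suc n - i) * coeff (q i) (Suc n - i)"
    using assms(6) by (simp add: Suc_diff_le)
  hence "x * ((-1) ^ (n - i) * coeff (q' i) (n - i)) > 0"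
    using F(4) by (simp only:)
  hence "x > 0" using F'(4) by (metis zero_less_mult_pos2)
  moreover have "poly (q (Suc i)) y - poly (q i) y = x * (y - r 0) * poly (q' i) y" for y
    using arg_cong[OF g(1), of "\<lambda>p. poly p y"] by (simp add: gx algebra_simps)
  ultimately show ?thesis by blast
qed

text \<open>\<open>p 0\<close> is a positive constant, which settles \<open>i = 0\<close>.
  Increments in \<open>i\<close> are nonnegative by positivity for the shifted nodes, which are one
  fewer; at \<open>l = 0\<close> they vanish.\<close>

lemma interp_fam_pos:
  assumes "0 < a" "a < 1" "strict_mono r" "interp_fam a r m p q" "i \<le> m" "l \<le> m"
  shows "poly (q i) (r l) > 0"
  using assms(3-)
proof (induction m arbitrary: r p q i l)
  case 0
  then show ?case using interp_famD(5)[of a r 0 p q 0] by simp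
next
  case (Suc n)
  note prems = Suc.prems and IH = Suc.IH
  have sm: "strict_mono (r \<circ> Suc)" using Suc.prems(1) by (simp add: strict_mono_def)
  obtain p' q' where F': "interp_fam a (r \<circ> Suc) n p' q'"
    using interp_fam_exists[OF assms(1,2) sm] by blast
  show ?case
    using Suc.prems(3)
  proof (induction i)
    case 0
    have "degree (p 0) = 0" "coeff (p 0) 0 > 0"
      using interp_famD(1,2)[OF prems(2), of 0] by (auto simp: deg_less_Suc_degree)
    hence "poly (p 0) x > 0" for x by (auto elim: degree_eq_zeroE)
    thus ?case using interp_famD(6)[OF prems(2), of 0 l] prems(4) assms(1) by simp
  next
    case (Suc i)
    from interp_fam_step[OF assms(1,2) prems(1,2) F', of i] Suc.prems
    obtain d where d: "d > 0" "\<And>x. poly (q (Suc i)) x - poly (q i) x = d * (x - r 0) * poly (q' i) x"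
      by auto
    have "d * (r l - r 0) * poly (q' i) (r l) \<ge> 0"
    proof (cases l)
      case (Suc l')
      hence "r l - r 0 > 0" using prems(1) by (simp add: strict_mono_less)
      moreover have "poly (q' i) (r l) > 0"
        using IH[OF sm F', of i l'] Suc Suc.prems prems(4) by simp
      ultimately show ?thesis using d(1) by simp
    qed simp
    with d(2)[of "r l"] Suc.IH Suc.prems show ?case by linarith
  qed
qed

lemma interp_fam_strict_mono:
  assumes "0 < a" "a < 1" "strict_mono r" "interp_fam a r m p q" "i < m" "l \<le> m" "0 < l"
  shows "poly (q i) (r l) < poly (q (Suc i)) (r l)"
proof -
  obtain n l' where n: "m = Suc n" "l = Suc l'" using assms(5,7) by (metis gr0_implies_Suc not_less_zero less_imp_Suc_add)
  have sm: "strict_mono (r \<circ> Suc)" using assms(3) by (simp add: strict_mono_def)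
  obtain p' q' where F': "interp_fam a (r \<circ> Suc) n p' q'"
    using interp_fam_exists[OF assms(1,2) sm] by blast
  obtain d where d: "d > 0" "\<And>x. poly (q (Suc i)) x - poly (q i) x = d * (x - r 0) * poly (q' i) x"
    using interp_fam_step[OF assms(1-3) assms(4)[unfolded n(1)] F', of i] assms(5) n(1) by auto
  have "poly (q' i) (r l) > 0"
    using interp_fam_pos[OF assms(1,2) sm F', of i l'] assms(5,6) n by simp
  moreover have "r l - r 0 > 0" using assms(3,7) by (simp add: strict_mono_less)
  ultimately have "d * (r l - r 0) * poly (q' i) (r l) > 0" using d(1) by simp
  thus ?thesis using d(2)[of "r l"] by simp
qed

lemma interp_fam_last:
  assumes "interp_fam a r m p q"
  shows "q m = 1"
proof -
  have "degree (q m) = 0" "poly (q m) (r 0) = 1"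
    using interp_famD(3,5)[OF assms, of m] by (auto simp: deg_less_Suc_degree)
  thus ?thesis by (auto elim!: degree_eq_zeroE simp: one_pCons)
qed

text \<open>Subtracting \<open>s\<close> times the next pair creates a zero at the last node
  \<open>R\<close>, and dividing by \<open>x - R\<close> leaves a pair for the remaining nodes.
  Normalisation at 0 yields the factor \<open>(1 - s) * (1 - x / R)\<close>; monotonicity of the
  control points yields \<open>s \<le> 1\<close>.\<close>

lemma interp_fam_tail:
  assumes "0 < a" "a < 1" "strict_mono r" "r 0 = 0" "interp_fam a r (Suc n) p q"
    "interp_fam a r n p' q'" "i \<le> n"
  shows "\<exists>s. 0 \<le> s \<and> s \<le> 1 \<and> (\<forall>x. poly (q i) x =
    s * poly (q (Suc i)) x + (1 - s) * ((1 - x / r (Suc n)) * poly (q' i) x))"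
proof -
  define R where "R = r (Suc n)"
  have R: "R > 0" using assms(3,4) strict_mono_less[OF assms(3), of 0 "Suc n"] by (simp add: R_def)
  define s where "s = poly (q i) R / poly (q (Suc i)) R"
  have i: "i \<le> Suc n" "Suc i \<le> Suc n" using assms(7) by auto
  have pos: "poly (q i) R > 0" "poly (q (Suc i)) R > 0"
    using interp_fam_pos[OF assms(1-3,5) i(1), of "Suc n"] interp_fam_pos[OF assms(1-3,5) i(2), of "Suc n"]
    by (auto simp: R_def)
  have "poly (q i) R < poly (q (Suc i)) R"
    using interp_fam_strict_mono[OF assms(1-3,5), of i "Suc n"] i by (simp add: R_def)
  hence s: "0 \<le> s" "s \<le> 1" using pos by (auto simp: s_def)
  note F = interp_famD[OF assms(5) i(1)] and G = interp_famD[OF assms(5) i(2)]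
  have "deg_less (Suc (Suc (n - i))) (q i - smult s (q (Suc i)))"
    using F(3) G(3) assms(7) deg_less_mono[of "Suc (n - i)" "q (Suc i)" "Suc (Suc (n - i))"]
    by (intro deg_less_diff deg_less_smult) (auto simp: Suc_diff_le)
  moreover have "poly (q i - smult s (q (Suc i))) R = 0" using pos by (simp add: s_def)
  ultimately obtain g where g: "q i - smult s (q (Suc i)) = [:- R, 1:] * g" "deg_less (Suc (n - i)) g"
    by (rule deg_less_factor)
  have "deg_less (Suc (Suc i)) (p i - smult s (p (Suc i)))"
    using F(1) G(1) deg_less_mono[of "Suc i" "p i" "Suc (Suc i)"] by (intro deg_less_diff deg_less_smult) auto
  moreover have "poly (p i - smult s (p (Suc i))) R = 0"
  proof -
    have "poly (p i - smult s (p (Suc i))) R * a powr R = poly (q i - smult s (q (Suc i))) R"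
      using F(6)[of "Suc n"] G(6)[of "Suc n"] by (simp add: R_def algebra_simps)
    also have "\<dots> = 0" using pos by (simp add: s_def)
    finally show ?thesis using assms(1) by simp
  qed
  ultimately obtain h where h: "p i - smult s (p (Suc i)) = [:- R, 1:] * h" "deg_less (Suc i) h"
    by (rule deg_less_factor)
  have gh: "poly g (r l) = poly h (r l) * a powr r l" if "l \<le> n" for l
  proof -
    have "r l - R \<noteq> 0" using strict_mono_eq[OF assms(3), of l "Suc n"] that by (simp add: R_def)
    moreover have "poly (q i - smult s (q (Suc i))) (r l) = poly (p i - smult s (p (Suc i))) (r l) * a powr r l"
      using F(6)[of l] G(6)[of l] that by (simp add: algebra_simps)
    hence "(r l - R) * poly g (r l) = (r l - R) * (poly h (r l) * a powr r l)"
      unfolding g(1) h(1) by (simp add: algebra_simps)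
    ultimately show ?thesis by (simp only: mult_cancel_left) simp
  qed
  have gx: "g = smult (poly g 0) (q' i)"
    using interp_fam_unique[OF assms(1-3,6,7) g(2) h(2) gh] by (simp add: assms(4))
  have "1 - s = - R * poly g 0"
    using arg_cong[OF g(1), of "\<lambda>p. poly p 0"] F(5) G(5) by (simp add: assms(4))
  hence g0: "poly g 0 = - (1 - s) / R" using R by (simp add: field_simps)
  have "poly (q i) x = s * poly (q (Suc i)) x + (1 - s) * ((1 - x / R) * poly (q' i) x)" for x
  proof -
    have "poly g x = poly g 0 * poly (q' i) x" using arg_cong[OF gx, of "\<lambda>p. poly p x"] by simp
    moreover have "poly (q i) x - s * poly (q (Suc i)) x = (x - R) * poly g x"
      using arg_cong[OF g(1), of "\<lambda>p. poly p x"] by (simp add: algebra_simps)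
    ultimately have "poly (q i) x - s * poly (q (Suc i)) x = (x - R) * (- (1 - s) / R * poly (q' i) x)"
      by (simp only: g0)
    also have "\<dots> = (1 - s) * ((1 - x / R) * poly (q' i) x)"
      using R by (simp add: field_simps)
    finally show ?thesis by simp
  qed
  with s show ?thesis unfolding R_def by blast
qed

text \<open>Iterates the removal of the last node, going down in \<open>i\<close> from
  \<open>q m = 1\<close>, the empty product at \<open>j = m\<close>. The weights do not depend on
  \<open>x\<close>, so the same ones serve for \<open>r 1\<close> and \<open>r k\<close>.\<close>

lemma interp_fam_mixture:
  assumes "0 < a" "a < 1" "strict_mono r" "r 0 = 0" "interp_fam a r m p q" "i \<le> m"
  shows "\<exists>w. (\<forall>j\<le>m. 0 \<le> w j) \<and> (\<Sum>j\<le>m. w j) = 1 \<and>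
    (\<forall>x. poly (q i) x = (\<Sum>j\<le>m. w j * (\<Prod>l\<in>{j<..m}. 1 - x / r l)))"
  using assms(5,6)
proof (induction m arbitrary: p q i)
  case 0
  thus ?case using interp_fam_last[of a r 0 p q] by (intro exI[of _ "\<lambda>_. 1"]) simp
next
  case (Suc n)
  obtain p' q' where F': "interp_fam a r n p' q'"
    using interp_fam_exists[OF assms(1-3)] by blast
  show ?case
    using Suc.prems(2)
  proof (induction i rule: inc_induct)
    case base
    show ?case
      using interp_fam_last[OF Suc.prems(1)]
      by (intro exI[of _ "\<lambda>j. if j = Suc n then 1 else 0"]) (simp add: if_distrib[of "\<lambda>x. x * _"] cong: if_cong)
  next
    case (step i)
    hence i: "i \<le> n" by simp
    obtain s where s: "0 \<le> s" "s \<le> 1" "\<And>x. poly (q i) x =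
        s * poly (q (Suc i)) x + (1 - s) * ((1 - x / r (Suc n)) * poly (q' i) x)"
      using interp_fam_tail[OF assms(1-4) Suc.prems(1) F' i] by blast
    obtain w where w: "\<And>j. j \<le> Suc n \<Longrightarrow> 0 \<le> w j" "(\<Sum>j\<le>Suc n. w j) = 1"
      "\<And>x. poly (q (Suc i)) x = (\<Sum>j\<le>Suc n. w j * (\<Prod>l\<in>{j<..Suc n}. 1 - x / r l))"
      using step.IH by blast
    obtain v where v: "\<And>j. j \<le> n \<Longrightarrow> 0 \<le> v j" "(\<Sum>j\<le>n. v j) = 1"
      "\<And>x. poly (q' i) x = (\<Sum>j\<le>n. v j * (\<Prod>l\<in>{j<..n}. 1 - x / r l))"
      using Suc.IH[OF F' i] by blast
    define u where "u j = s * w j + (1 - s) * (if j \<le> n then v j else 0)" for j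
    have "0 \<le> u j" if "j \<le> Suc n" for j
      using that s v(1)[of j] w(1)[of j] by (auto simp: u_def)
    moreover have "(\<Sum>j\<le>Suc n. u j) = 1"
      using w(2) v(2) by (simp add: u_def sum.distrib flip: sum_distrib_left)
    moreover have "poly (q i) x = (\<Sum>j\<le>Suc n. u j * (\<Prod>l\<in>{j<..Suc n}. 1 - x / r l))" for x
    proof -
      have "(1 - x / r (Suc n)) * poly (q' i) x = (\<Sum>j\<le>n. v j * (\<Prod>l\<in>{j<..Suc n}. 1 - x / r l))"
        unfolding v(3) sum_distrib_left
      proof (intro sum.cong refl)
        fix j assume "j \<in> {..n}"
        hence "{j<..Suc n} = insert (Suc n) {j<..n}" by auto
        thus "(1 - x / r (Suc n)) * (v j * (\<Prod>l\<in>{j<..n}. 1 - x / r l)) =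
            v j * (\<Prod>l\<in>{j<..Suc n}. 1 - x / r l)" by simp
      qed
      also have "\<dots> = (\<Sum>j\<le>Suc n. (if j \<le> n then v j else 0) * (\<Prod>l\<in>{j<..Suc n}. 1 - x / r l))"
        by simp
      finally have T: "(1 - x / r (Suc n)) * poly (q' i) x =
          (\<Sum>j\<le>Suc n. (if j \<le> n then v j else 0) * (\<Prod>l\<in>{j<..Suc n}. 1 - x / r l))" .
      show ?thesis
        unfolding s(3) w(3) T u_def sum_distrib_left sum.distrib[symmetric]
        by (intro sum.cong refl) (simp add: algebra_simps)
    qed
    ultimately show ?case by blast
  qed
qed

section \<open>Asymptotics\<close>

context interp_basis
begin

text \<open>A supporting line of the control polygon at vertex \<open>i\<close> is averaged with the
  positive weights \<open>B j t\<close>, where the curve has abscissa \<open>x i\<close> at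
  \<open>t\<close>. The extreme indices are computed directly, since \<open>t\<close> would be an
  endpoint there.\<close>

lemma q_le_powr:
  assumes k: "1 \<le> k" "k \<le> m" and i: "i \<le> m"
  shows "poly (q i) (r k) \<le> poly (q i) (r 1) powr (r k / r 1)"
proof -
  have r1: "r 1 > 0" using strict_mono_less[OF r, of 0 1] r0 by simp
  have rk: "r k > 0" using strict_mono_less[OF r, of 0 k] k r0 by simp
  define x where "x j = poly (q j) (r 1)" for j
  define y where "y j = poly (q j) (r k)" for j
  have x_mono: "x j < x (Suc j)" if "j < m" for j
    using interp_fam_strict_mono[OF a r fam that] k by (simp add: x_def)
  have x0: "x 0 = a powr r 1" and y0: "y 0 = a powr r k"
  proof -
    have "degree (p 0) = 0" "poly (p 0) 0 = 1"
      using interp_famD(1,5)[OF fam, of 0] interp_famD(6)[OF fam, of 0 0] a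
      by (auto simp: deg_less_Suc_degree r0)
    hence "poly (p 0) z = 1" for z by (auto elim: degree_eq_zeroE)
    thus "x 0 = a powr r 1" "y 0 = a powr r k"
      using interp_famD(6)[OF fam, of 0] k by (auto simp: x_def y_def)
  qed
  have xm: "x m = 1" "y m = 1" using interp_fam_last[OF fam] by (auto simp: x_def y_def)
  consider "i = 0" | "i = m" | "0 < i" "i < m" using i by linarith
  thus ?thesis
  proof cases
    case 1
    thus ?thesis using x0 y0 r1 by (simp add: x_def y_def powr_powr)
  next
    case 2
    thus ?thesis using xm by (simp add: x_def y_def)
  next
    case 3
    obtain n where n: "m = Suc n" using k by (cases m) auto
    have sm: "strict_mono (r \<circ> Suc)" using r by (simp add: strict_mono_def)
    obtain p' q' where F': "interp_fam a (r \<circ> Suc) n p' q'"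
      using interp_fam_exists[OF a sm] by blast
    have "\<forall>j\<le>n. \<exists>d>0. \<forall>z. poly (q (Suc j)) z - poly (q j) z = d * (z - r 0) * poly (q' j) z"
      using interp_fam_step[OF a r fam[unfolded n] F'] by blast
    then obtain d where d: "\<And>j. j \<le> n \<Longrightarrow> d j > 0"
      "\<And>j z. j \<le> n \<Longrightarrow> poly (q (Suc j)) z - poly (q j) z = d j * z * poly (q' j) z"
      unfolding r0 by (metis diff_zero)
    obtain k' where k': "k = Suc k'" "k' \<le> n" using k n by (cases k) auto
    \<comment> \<open>Up to the factor \<open>r k / r 1\<close> this is the slope of edge
      \<open>j\<close> of the control polygon.\<close>
    define S where "S j = poly (q' j) (r k)" for j
    have dx: "x (Suc j) - x j = d j * r 1" if "j \<le> n" for j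
      using d(2)[OF that, of "r 1"] interp_famD(5)[OF F' that] by (simp add: x_def)
    have dy: "y (Suc j) - y j = d j * r k * S j" if "j \<le> n" for j
      using d(2)[OF that, of "r k"] by (simp add: y_def S_def)
    have S_mono: "S j \<le> S j'" if "j \<le> j'" "j' \<le> n" for j j'
      using that
    proof (induction j' rule: dec_induct)
      case (step l)
      have "S l \<le> S (Suc l)"
      \<comment> \<open>For \<open>k = 1\<close> the point \<open>r k\<close> is the normalisation
        node of the shifted family, so \<open>S\<close> is constantly 1.\<close>
      proof (cases "k' = 0")
        case True
        thus ?thesis using interp_famD(5)[OF F'] step k' by (simp add: S_def)
      next
        case False
        thus ?thesis
          using interp_fam_strict_mono[OF a sm F', of l k'] step k' by (simp add: S_def)
      qed
      with step show ?case by simp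
    qed simp
    define s where "s = r k / r 1 * S i"
    have s: "s * (d j * r 1) = d j * r k * S i" for j using r1 by (simp add: s_def)
    \<comment> \<open>supporting line of the convex control polygon at its vertex \<open>i\<close>\<close>
    have incr: "(y (Suc j) - s * x (Suc j)) - (y j - s * x j) = d j * r k * (S j - S i)" if "j \<le> n" for j
    proof -
      have "(y (Suc j) - s * x (Suc j)) - (y j - s * x j) = (y (Suc j) - y j) - s * (x (Suc j) - x j)"
        by (simp add: algebra_simps)
      also have "\<dots> = d j * r k * S j - d j * r k * S i"
        by (simp only: dx[OF that] dy[OF that] s)
      finally show ?thesis by (simp add: algebra_simps)
    qed
    have up: "y i - s * x i \<le> y j - s * x j" if "i \<le> j" "j \<le> m" for j
      using that
    proof (induction j rule: dec_induct)
      case (step j)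
      have "0 \<le> d j * r k * (S j - S i)"
        using d(1)[of j] rk S_mono[of i j] step n by (intro mult_nonneg_nonneg) auto
      thus ?case using incr[of j] step n by simp
    qed simp
    have down: "y i - s * x i \<le> y j - s * x j" if "j \<le> i" for j
      using that
    proof (induction j rule: inc_induct)
      case (step j)
      have "0 \<le> d j * r k * (S i - S j)"
        using d(1)[of j] rk S_mono[of j i] step 3 n by (intro mult_nonneg_nonneg) auto
      hence "d j * r k * (S j - S i) \<le> 0" by (simp add: algebra_simps)
      thus ?case using incr[of j] step 3 n by simp
    qed simp
    have supp: "y i - s * x i \<le> y j - s * x j" if "j \<le> m" for j
      using up[of j] down[of j] that by linarith
    have xi: "a powr r 1 < x i" "x i < 1"
    proof -
      have "x j < x j'" if "j < j'" "j' \<le> m" for j j'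
        using that
      proof (induction j')
        case (Suc j')
        have "x j' < x (Suc j')" using x_mono Suc.prems by simp
        thus ?case using Suc by (cases "j = j'") auto
      qed simp
      thus "a powr r 1 < x i" "x i < 1" using 3 x0 xm by force+
    qed
    \<comment> \<open>The parameter at which the curve has abscissa \<open>x i\<close>; strict
      monotonicity of \<open>x\<close> puts it strictly between \<open>a\<close> and 1.\<close>
    define t where "t = x i powr (1 / r 1)"
    have xi0: "x i > 0" using xi(1) powr_ge_zero[of a "r 1"] by linarith
    have "(a powr r 1) powr (1 / r 1) < t"
      unfolding t_def using xi r1 a by (intro powr_less_mono2) auto
    hence ta: "a < t" using r1 a by (simp add: powr_powr)
    have "t < 1 powr (1 / r 1)"
      unfolding t_def using xi xi0 r1 by (intro powr_less_mono2) auto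
    hence t1: "t < 1" by simp
    have t: "t powr r 1 = x i" "t powr r k = x i powr (r k / r 1)"
      using r1 xi0 by (simp_all add: t_def powr_powr)
    have "(\<Sum>j\<le>m. (y i - s * x i) * B j t) \<le> (\<Sum>j\<le>m. (y j - s * x j) * B j t)"
      using supp B_pos[OF _ ta t1] by (intro sum_mono mult_right_mono) (auto intro: less_imp_le)
    also have "\<dots> = (\<Sum>j\<le>m. y j * B j t) - s * (\<Sum>j\<le>m. x j * B j t)"
      by (simp add: left_diff_distrib sum_subtractf sum_distrib_left mult.assoc)
    also have "\<dots> = t powr r k - s * t powr r 1"
      using powr_eq_sum_B[OF k(2), of t] powr_eq_sum_B[of 1 t] k by (simp add: x_def y_def)
    also have "(\<Sum>j\<le>m. (y i - s * x i) * B j t) = y i - s * x i"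
      using B_sum_1[of t] ta a by (simp flip: sum_distrib_left)
    finally have "y i \<le> t powr r k" unfolding t by simp
    thus ?thesis by (simp add: t x_def y_def)
  qed
qed

end

lemma interp_basis_exists:
  assumes "0 < a" "a < 1" "strict_mono r" "r 0 = 0"
  shows "\<exists>p q c. interp_basis a r m p q c"
proof -
  obtain p q where F: "interp_fam a r m p q" using interp_fam_exists[OF assms(1-3)] by blast
  with interp_fam_dual[OF assms(3) this] show ?thesis
    using assms unfolding interp_basis_def by blast
qed

section \<open>Jensen's inequality and elementary estimates for powers\<close>

lemma powr_above_tangent:
  assumes "(1::real) \<le> \<rho>" "0 < c" "0 \<le> x"
  shows "c powr \<rho> + \<rho> * c powr (\<rho> - 1) * (x - c) \<le> x powr \<rho>"
\<comment> \<open>Convexity is used on the open half-line, so the boundary point is checked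
  directly.\<close>
proof (cases "x = 0")
  case True
  have "c powr (\<rho> - 1) * c = c powr \<rho>"
    using assms(2) by (simp add: powr_diff)
  hence "c powr \<rho> + \<rho> * c powr (\<rho> - 1) * (x - c) = (1 - \<rho>) * c powr \<rho>"
    using True by (simp add: algebra_simps)
  also have "\<dots> \<le> 0" using assms(1) by (simp add: mult_nonpos_nonneg)
  finally show ?thesis using True by simp
next
  case False
  have "((\<lambda>x. x powr \<rho>) has_real_derivative \<rho> * c powr (\<rho> - 1)) (at c within {0<..})"
    using has_real_derivative_powr[OF assms(2)] has_field_derivative_at_within by blast
  hence "\<rho> * c powr (\<rho> - 1) * (x - c) \<le> x powr \<rho> - c powr \<rho>"
    using assms False
    by (intro convex_on_imp_above_tangent[OF powr_convex[OF assms(1)]]) (auto simp: interior_open)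
  thus ?thesis by simp
qed

lemma powr_sum_le:
  assumes "(1::real) \<le> \<rho>" "\<And>j. j \<le> m \<Longrightarrow> 0 \<le> w j" "(\<Sum>j\<le>m. w j) = 1"
    "\<And>j. j \<le> m \<Longrightarrow> 0 \<le> x j"
  shows "(\<Sum>j\<le>m. w j * x j) powr \<rho> \<le> (\<Sum>j\<le>(m::nat). w j * x j powr \<rho>)"
proof -
  define c where "c = (\<Sum>j\<le>m. w j * x j)"
  have "c \<ge> 0" unfolding c_def using assms by (intro sum_nonneg mult_nonneg_nonneg) auto
  show ?thesis
  proof (cases "c = 0")
    case True
    have "0 \<le> (\<Sum>j\<le>m. w j * x j powr \<rho>)"
      using assms by (intro sum_nonneg mult_nonneg_nonneg) auto
    with True show ?thesis by (simp add: c_def)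
  next
    case False
    hence c: "c > 0" using \<open>c \<ge> 0\<close> by simp
    \<comment> \<open>The tangent is taken at the mean \<open>c\<close>, where its linear term
      averages to zero.\<close>
    have "c powr \<rho> = (\<Sum>j\<le>m. w j * c powr \<rho>) +
        \<rho> * c powr (\<rho> - 1) * ((\<Sum>j\<le>m. w j * x j) - (\<Sum>j\<le>m. w j) * c)"
      using assms(3) by (simp add: c_def flip: sum_distrib_right)
    also have "\<dots> = (\<Sum>j\<le>m. w j * (c powr \<rho> + \<rho> * c powr (\<rho> - 1) * (x j - c)))"
      by (simp add: algebra_simps sum.distrib sum_subtractf sum_distrib_left sum_distrib_right)
    also have "\<dots> \<le> (\<Sum>j\<le>m. w j * x j powr \<rho>)"
      using assms powr_above_tangent[OF assms(1) c] by (intro sum_mono mult_left_mono) auto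
    finally show ?thesis by (simp add: c_def)
  qed
qed

text \<open>In logarithms, the surplus \<open>\<rho> * h * \<delta>\<close> from the factor
  \<open>1 + \<delta>\<close> absorbs the quadratic error of \<open>ln (1 - \<rho> * h)\<close> for
  small \<open>h\<close>.\<close>

lemma one_minus_ge_powr:
  fixes \<delta> \<rho> :: real
  assumes "0 < \<delta>" "0 < \<rho>"
  shows "\<exists>h0>0. \<forall>h. 0 \<le> h \<and> h \<le> h0 \<longrightarrow> h < 1 \<and> (1 - h) powr (\<rho> * (1 + \<delta>)) \<le> 1 - \<rho> * h"
proof -
  \<comment> \<open>The three bounds give \<open>h < 1\<close>, the range of the logarithmic lower
    bound, and the absorption of the quadratic term.\<close>
  define h0 where "h0 = min (1 / 2) (min (1 / (2 * \<rho>)) (\<delta> / (2 * \<rho>)))"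
  have "h0 > 0" using assms by (simp add: h0_def)
  moreover have "h < 1 \<and> (1 - h) powr (\<rho> * (1 + \<delta>)) \<le> 1 - \<rho> * h" if h: "0 \<le> h" "h \<le> h0" for h
  proof -
    have h1: "h \<le> 1 / 2" "\<rho> * h \<le> 1 / 2" "2 * (\<rho> * h) \<le> \<delta>"
      using h assms by (auto simp: h0_def field_simps)
    have "ln (1 - h) \<le> - h" using h1(1) ln_le_minus_one[of "1 - h"] by simp
    hence "\<rho> * (1 + \<delta>) * ln (1 - h) \<le> \<rho> * (1 + \<delta>) * (- h)"
      using assms by (intro mult_left_mono) auto
    also have "\<dots> = - (\<rho> * h) - (\<rho> * h) * \<delta>" by (simp add: algebra_simps)
    also have "\<dots> \<le> - (\<rho> * h) - (\<rho> * h) * (2 * (\<rho> * h))"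
      using mult_left_mono[OF h1(3), of "\<rho> * h"] h assms by simp
    also have "\<dots> = - (\<rho> * h) - 2 * (\<rho> * h)\<^sup>2" by (simp add: power2_eq_square)
    also have "\<dots> \<le> ln (1 - \<rho> * h)"
      using h h1 assms by (intro ln_one_minus_pos_lower_bound) auto
    finally have "exp (\<rho> * (1 + \<delta>) * ln (1 - h)) \<le> exp (ln (1 - \<rho> * h))" by simp
    thus ?thesis using h1 by (simp add: powr_def)
  qed
  ultimately show ?thesis by blast
qed

text \<open>The difference is at most \<open>\<delta> * (- z * ln z)\<close>, and
  \<open>- z * ln z\<close> is at most 1.\<close>

lemma powr_diff_le:
  assumes "0 \<le> (z::real)" "z \<le> 1" "0 < \<delta>"
  shows "z - z powr (1 + \<delta>) \<le> \<delta>"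
proof (cases "z = 0")
  case False
  hence z: "z > 0" using assms by simp
  have "1 + \<delta> * ln z \<le> z powr \<delta>"
    using exp_ge_add_one_self[of "\<delta> * ln z"] z by (simp add: powr_def)
  hence "z * (1 + \<delta> * ln z) \<le> z * z powr \<delta>" using z by (intro mult_left_mono) auto
  moreover have "z * z powr \<delta> = z powr (1 + \<delta>)" using z by (simp add: powr_add)
  moreover have "z * (- ln z) \<le> 1"
  proof -
    have "- ln z \<le> 1 / z - 1" using ln_le_minus_one[of "1 / z"] z by (simp add: ln_div)
    hence "z * (- ln z) \<le> z * (1 / z - 1)" using z by (intro mult_left_mono) auto
    also have "\<dots> \<le> 1" using z by (simp add: algebra_simps)
    finally show ?thesis .
  qed
  hence "\<delta> * (z * (- ln z)) \<le> \<delta> * 1" using assms by (intro mult_left_mono) auto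
  ultimately show ?thesis by (simp add: algebra_simps)
qed (use assms in simp)

section \<open>Asymptotics of the products under the Muntz condition\<close>

lemma prod_tendsto_0:
  fixes r :: "nat \<Rightarrow> real"
  assumes "r 0 = 0" "strict_mono r" "\<not> summable (\<lambda>i. 1 / r (Suc i))"
  shows "(\<lambda>m. \<Prod>l\<in>{J<..m}. 1 - r 1 / r l) \<longlonglongrightarrow> 0"
proof -
  have rpos: "r l > 0" if "l > 0" for l using strict_mono_less[OF assms(2), of 0 l] assms(1) that by simp
  have r1: "r 1 \<le> r l" if "l > 0" for l using strict_mono_less_eq[OF assms(2), of 1 l] that by simp
  have h: "0 \<le> 1 - r 1 / r l" if "l > 0" for l
    using rpos[OF that] r1[OF that] by simp
  define f where "f i = 1 / r (Suc (i + J))" for i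
  have f: "f i \<ge> 0" for i using rpos[of "Suc (i + J)"] by (simp add: f_def)
  have ns: "\<not> summable f"
    using assms(3) summable_iff_shift[of "\<lambda>i. 1 / r (Suc i)" J] unfolding f_def by simp
  show ?thesis
  proof (rule LIMSEQ_I)
    fix e :: real assume e: "e > 0"
    \<comment> \<open>By \<open>1 - u \<le> exp (- u)\<close>, a partial sum above
      \<open>- ln e / r 1\<close> forces all longer products below \<open>e\<close>.\<close>
    obtain n where n: "(\<Sum>i<n. f i) > - ln e / r 1"
      using summableI_nonneg_bounded[of f "- ln e / r 1"] f ns by (meson not_le)
    have "norm ((\<Prod>l\<in>{J<..m}. 1 - r 1 / r l) - 0) < e" if m: "m \<ge> J + n" for m
    proof -
      have "(\<Prod>l\<in>{J<..m}. 1 - r 1 / r l) = (\<Prod>i<m - J. 1 - r 1 * f i)"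
        by (rule prod.reindex_bij_witness[of _ "\<lambda>i. Suc (i + J)" "\<lambda>l. l - Suc J"]) (auto simp: f_def)
      also have "\<dots> \<le> (\<Prod>i<m - J. exp (- (r 1 * f i)))"
        using h[of "Suc (_ + J)"] exp_ge_add_one_self[of "- (r 1 * f _)"]
        by (intro prod_mono) (auto simp: f_def)
      also have "\<dots> = exp (- (r 1 * (\<Sum>i<m - J. f i)))"
        by (simp add: exp_sum sum_distrib_left flip: sum_negf)
      also have "\<dots> \<le> exp (- (r 1 * (\<Sum>i<n. f i)))"
        using m f rpos[of 1] by (auto intro!: mult_left_mono sum_mono2)
      also have "\<dots> < exp (ln e)"
        using n rpos[of 1] by (simp add: field_simps)
      also have "\<dots> = e" using e by simp
      finally have "(\<Prod>l\<in>{J<..m}. 1 - r 1 / r l) < e" .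
      moreover have "0 \<le> (\<Prod>l\<in>{J<..m}. 1 - r 1 / r l)"
        using h by (intro prod_nonneg) auto
      ultimately show ?thesis by simp
    qed
    thus "\<exists>no. \<forall>m\<ge>no. norm ((\<Prod>l\<in>{J<..m}. 1 - r 1 / r l) - 0) < e" by blast
  qed
qed

text \<open>For \<open>j < J\<close> the factors beyond \<open>J\<close> make the power small,
  uniformly in \<open>j\<close>, and nonnegativity of the right side suffices. For
  \<open>j \<ge> J\<close> every ratio \<open>r 1 / r l\<close> is small, and the factorwise
  comparison costs only the exponent \<open>1 + \<delta>\<close>.\<close>

lemma prod_powr_close:
  fixes r :: "nat \<Rightarrow> real"
  assumes "r 0 = 0" "strict_mono r" "filterlim r at_top sequentially"
    "\<not> summable (\<lambda>i. 1 / r (Suc i))" "0 < k" "0 < \<delta>"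
  shows "\<forall>\<^sub>F m in sequentially. \<forall>j\<le>m.
    (\<Prod>l\<in>{j<..m}. 1 - r 1 / r l) powr (r k / r 1) - \<delta> \<le> (\<Prod>l\<in>{j<..m}. 1 - r k / r l)"
proof -
  have rpos: "r l > 0" if "l > 0" for l using strict_mono_less[OF assms(2), of 0 l] assms(1) that by simp
  have rmono: "r l \<le> r l'" if "l \<le> l'" for l l' using strict_mono_less_eq[OF assms(2)] that by simp
  define \<rho> where "\<rho> = r k / r 1"
  have \<rho>: "\<rho> \<ge> 1" using rpos[of 1] rmono[of 1 k] assms(5) by (simp add: \<rho>_def)
  have h: "0 \<le> 1 - r 1 / r l" "1 - r 1 / r l \<le> 1" if "l > 0" for l
    using rpos[OF that] rmono[of 1 l] rpos[of 1] that by auto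
  obtain h0 where h0: "h0 > 0"
    "\<And>h. 0 \<le> h \<Longrightarrow> h \<le> h0 \<Longrightarrow> h < 1 \<and> (1 - h) powr (\<rho> * (1 + \<delta>)) \<le> 1 - \<rho> * h"
    using one_minus_ge_powr[of \<delta> \<rho>] assms(6) \<rho> by auto
  have "\<forall>\<^sub>F l in sequentially. r 1 / h0 \<le> r l"
    using assms(3) by (simp add: filterlim_at_top)
  then obtain J0 where J0: "\<And>l. l \<ge> J0 \<Longrightarrow> r 1 / h0 \<le> r l"
    by (auto simp: eventually_sequentially)
  \<comment> \<open>Beyond \<open>J0\<close> the ratios are at most \<open>h0\<close>. The maximum
    with \<open>k\<close> ensures \<open>k \<le> m\<close>, so a product starting below
    \<open>k\<close> contains its zero factor.\<close>
  define J where "J = max J0 k"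
  have "\<forall>\<^sub>F m in sequentially. (\<Prod>l\<in>{J<..m}. 1 - r 1 / r l) < \<delta>"
    using prod_tendsto_0[OF assms(1,2,4), of J] assms(6) by (simp add: order_tendsto_iff)
  moreover have "\<forall>\<^sub>F m in sequentially. m \<ge> J" by (rule eventually_ge_at_top)
  ultimately show ?thesis
  proof eventually_elim
    case (elim m)
    show ?case
    proof (intro allI impI)
      fix j assume j: "j \<le> m"
      define x where "x = (\<Prod>l\<in>{j<..m}. 1 - r 1 / r l)"
      define y where "y = (\<Prod>l\<in>{j<..m}. 1 - r k / r l)"
      have x: "0 \<le> x" "x \<le> 1" unfolding x_def using h by (auto intro!: prod_nonneg prod_le_1)
      have "x powr \<rho> - \<delta> \<le> y"
      proof (cases "j < J")
        case True
        have "x powr \<rho> \<le> x powr 1" using x \<rho> by (intro powr_mono') auto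
        also have "x powr 1 = x" using x by simp
        also have "x = (\<Prod>l\<in>{j<..J}. 1 - r 1 / r l) * (\<Prod>l\<in>{J<..m}. 1 - r 1 / r l)"
        proof -
          have "{j<..m} = {j<..J} \<union> {J<..m}" using True elim by auto
          thus ?thesis unfolding x_def by (simp add: prod.union_disjoint)
        qed
        also have "\<dots> \<le> 1 * (\<Prod>l\<in>{J<..m}. 1 - r 1 / r l)"
          using h by (intro mult_right_mono) (auto intro!: prod_nonneg prod_le_1)
        finally have "x powr \<rho> \<le> \<delta>" using elim by simp
        moreover have "y \<ge> 0"
        proof (cases "j < k")
          case True
          hence "k \<in> {j<..m}" using elim by (auto simp: J_def)
          hence "y = 0" unfolding y_def using rpos[OF assms(5)] by (intro prod_zero bexI[of _ k]) auto
          thus ?thesis by simp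
        next
          case False
          have "0 \<le> 1 - r k / r l" if "l \<in> {j<..m}" for l
            using rmono[of k l] rpos[of l] that False by simp
          thus ?thesis unfolding y_def by (intro prod_nonneg) auto
        qed
        ultimately show ?thesis by simp
      next
        case False
        have "(\<Prod>l\<in>{j<..m}. (1 - r 1 / r l) powr (\<rho> * (1 + \<delta>))) \<le> y"
          unfolding y_def
        proof (intro prod_mono conjI)
          fix l assume l: "l \<in> {j<..m}"
          have "J0 \<le> l" using l False by (auto simp: J_def less_max_iff_disj)
          hence "r 1 / r l \<le> h0"
            using J0[of l] l h0(1) rpos[of l] by (simp add: field_simps)
          thus "(1 - r 1 / r l) powr (\<rho> * (1 + \<delta>)) \<le> 1 - r k / r l"
            using h0(2)[of "r 1 / r l"] rpos[of 1] rpos[of l] l by (simp add: \<rho>_def)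
        qed auto
        also have "(\<Prod>l\<in>{j<..m}. (1 - r 1 / r l) powr (\<rho> * (1 + \<delta>))) = x powr (\<rho> * (1 + \<delta>))"
          unfolding x_def by (intro prod_powr_distrib[symmetric])
        also have "\<dots> = (x powr \<rho>) powr (1 + \<delta>)" by (simp add: powr_powr)
        finally show ?thesis
          using powr_diff_le[of "x powr \<rho>" \<delta>] x \<rho> assms(6) by (simp add: powr_le1)
      qed
      thus "x powr (r k / r 1) - \<delta> \<le> y" by (simp add: \<rho>_def)
    qed
  qed
qed

theorem theorem7:
  fixes r :: "nat \<Rightarrow> real" and a :: real and k :: nat
  assumes "r 0 = 0" and "strict_mono r"
    and "filterlim r at_top sequentially"
    and "\<not> summable (\<lambda>i. 1 / r (Suc i))"
    and "0 < a" and "a < 1"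
    and "0 < k"
  shows "(\<lambda>m. Max {\<bar>ctrl_pt (\<lambda>t. t powr r 1) r m a 1 i powr (r k / r 1)
                     - ctrl_pt (\<lambda>t. t powr r k) r m a 1 i\<bar> | i. i \<le> m})
           \<longlonglongrightarrow> 0"
proof (rule tendstoI)
  fix e :: real assume "e > 0"
  define \<rho> where "\<rho> = r k / r 1"
  define err where "err m i = \<bar>ctrl_pt (\<lambda>t. t powr r 1) r m a 1 i powr \<rho>
    - ctrl_pt (\<lambda>t. t powr r k) r m a 1 i\<bar>" for m i
  have rpos: "r l > 0" if "l > 0" for l using strict_mono_less[OF assms(2), of 0 l] assms(1) that by simp
  have rmono: "r l \<le> r l'" if "l \<le> l'" for l l' using strict_mono_less_eq[OF assms(2)] that by simp
  have \<rho>: "\<rho> \<ge> 1" using rpos[of 1] rmono[of 1 k] assms(7) by (simp add: \<rho>_def)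
  have "\<forall>\<^sub>F m in sequentially. m \<ge> k" by (rule eventually_ge_at_top)
  \<comment> \<open>Half of \<open>e\<close> leaves room for the strict bound on the
    maximum.\<close>
  moreover have "e / 2 > 0" using \<open>e > 0\<close> by simp
  note prod_powr_close[OF assms(1-4,7) this]
  ultimately have "\<forall>\<^sub>F m in sequentially. \<forall>i\<le>m. err m i \<le> e / 2"
  proof eventually_elim
    case (elim m)
    obtain p q c where "interp_basis a r m p q c"
      using interp_basis_exists[OF assms(5,6,2,1)] by blast
    then interpret interp_basis a r m p q c .
    show ?case
    proof (intro allI impI)
      fix i assume i: "i \<le> m"
      have up: "poly (q i) (r k) \<le> poly (q i) (r 1) powr \<rho>"
        unfolding \<rho>_def using elim i assms(7) by (intro q_le_powr) auto
      define v where "v z j = (\<Prod>l\<in>{j<..m}. 1 - z / r l)" for z j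
      obtain w where w: "\<And>j. j \<le> m \<Longrightarrow> 0 \<le> w j" "(\<Sum>j\<le>m. w j) = 1"
        "\<And>x. poly (q i) x = (\<Sum>j\<le>m. w j * v x j)"
        using interp_fam_mixture[OF a r r0 fam i] unfolding v_def by blast
      \<comment> \<open>Jensen moves the power inside the mixture; each product is then compared
        with its counterpart for \<open>r k\<close> under the same weights, which sum to 1, so the
        total error is at most \<open>e / 2\<close>.\<close>
      have "poly (q i) (r 1) powr \<rho> \<le> (\<Sum>j\<le>m. w j * v (r 1) j powr \<rho>)"
        unfolding w(3)
      proof (rule powr_sum_le)
        show "0 \<le> v (r 1) j" for j
          unfolding v_def using rpos rmono[of 1] by (auto intro!: prod_nonneg)
      qed (use \<rho> w in auto)
      also have "\<dots> \<le> (\<Sum>j\<le>m. w j * (v (r k) j + e / 2))"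
        using elim(2) w(1) by (intro sum_mono mult_left_mono) (auto simp: v_def \<rho>_def algebra_simps)
      also have "\<dots> = poly (q i) (r k) + e / 2"
        using w(2) by (simp add: w(3) distrib_left sum.distrib flip: sum_distrib_right sum_divide_distrib)
      finally show "err m i \<le> e / 2"
        using up ctrl_pt_powr[of 1 i] ctrl_pt_powr[of k i] i elim(1) assms(7) by (simp add: err_def)
    qed
  qed
  thus "\<forall>\<^sub>F m in sequentially. dist (Max {\<bar>ctrl_pt (\<lambda>t. t powr r 1) r m a 1 i powr (r k / r 1)
      - ctrl_pt (\<lambda>t. t powr r k) r m a 1 i\<bar> | i. i \<le> m}) 0 < e"
  proof eventually_elim
    case (elim m)
    have eq: "{\<bar>ctrl_pt (\<lambda>t. t powr r 1) r m a 1 i powr (r k / r 1)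
      - ctrl_pt (\<lambda>t. t powr r k) r m a 1 i\<bar> | i. i \<le> m} = err m ` {..m}"
      by (auto simp: err_def \<rho>_def)
    have "Max (err m ` {..m}) \<le> e / 2"
      using elim by (subst Max_le_iff) auto
    moreover have "0 \<le> Max (err m ` {..m})"
      by (subst Max_ge_iff) (auto simp: err_def)
    ultimately show ?case unfolding eq dist_real_def using \<open>e > 0\<close> by linarith
  qed
qed

end
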